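(* Let $d\ge 3$ and let $H\le\mathrm{Aut}(T_d)$ be locally transitive and contain an involutive inversion. Then there are a labelling $l$ of $T_d$ and, for every $k\in\mathbb{N}$, a subgroup $F^{(k)}\le\mathrm{Aut}(B_{d,k})$ which is action isomorphic to the $k$-local action of $H$, such that $$\mathrm{U}_1^{(l)}(F^{(1)})\ge\mathrm{U}_2^{(l)}(F^{(2)})\ge\cdots\ge\mathrm{U}_k^{(l)}(F^{(k)})\ge\cdots\ge H\ge\mathrm{U}_1^{(l)}(\{\mathrm{id}\}).$$
   Context: $\Omega$ is a set of cardinality $d\ge3$, and $T_d=(V,E)$ is the $d$-regular tree (Serre's convention: $E$ consists of oriented edges with inversion $e\mapsto\overline e$, $E(x)$ is the set of edges with origin $x$). An inversion is an automorphism mapping some edge $e$ to $\overline e$; it is involutive if it has order $2$. $H$ is locally transitive if for every $x\in V$ the stabilizer $H_x$ acts transitively on $E(x)$. A labelling of $T_d$ is a map $l:E\to\Omega$ such that for each $x\in V$ the restriction $l_x:E(x)\to\Omega$ is bijective, and $l(e)=l(\overline e)$ for all $e\in E$. For $k\in\mathbb{N}=\{1,2,\dots\}$, $B_{d,k}$ is a fixed labelled tree isomorphic to a ball of radius $k$ in the labelled tree $T_d$; for $x\in V$ let $l_x^k:B(x,k)\to B_{d,k}$ be the unique label-respecting isomorphism. The $k$-local action of $g\in\mathrm{Aut}(T_d)$ at $x$ is $\sigma_k(g,x):=l_{gx}^k\circ g\circ(l_x^k)^{-1}\in\mathrm{Aut}(B_{d,k})$. For $F\le\mathrm{Aut}(B_{d,k})$,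 $$\mathrm{U}_k^{(l)}(F):=\{g\in\mathrm{Aut}(T_d)\mid\forall x\in V:\ \sigma_k(g,x)\in F\}.$$ $F^{(k)}$ being action isomorphic to the $k$-local action of $H$ means that, for every $x\in V$, the action of (the group induced by) $H_x$ on the ball $B(x,k)$ is isomorphic to the action of $F^{(k)}$ on $B_{d,k}$. *)

theory Defs
  imports
    "Graph_Theory.Bidirected_Digraph"
    "Graph_Theory.Arc_Walk"
    "Graph_Theory.Digraph_Component"
    "HOL-Algebra.Multiplicative_Group"
begin

text \<open>
  Graphs in the sense of Serre: a digraph together with an inversion of its arcs.
  Isomorphisms and labellings only see the inversion on the set of arcs.
\<close>

record ('v, 'e) serre_graph =
  und :: "('v, 'e) pre_digraph"
  bar :: "'e \<Rightarrow> 'e"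

abbreviation V :: "('v, 'e) serre_graph \<Rightarrow> 'v set" where
  "V G \<equiv> verts (und G)"

abbreviation E :: "('v, 'e) serre_graph \<Rightarrow> 'e set" where
  "E G \<equiv> arcs (und G)"

text \<open>
  A circuit of length \<open>n \<ge> 1\<close> is a cycle of the underlying digraph that does not contain both an edge
  and its inverse; the extra condition only excludes the cycles of the form \<open>[e, bar e]\<close>.
  The locale \<open>bidirected_digraph\<close> demands an involution of the arcs without fixed points that swaps
  tails and heads (extended by the identity outside the set of arcs); strong connectedness includes that the vertex set is nonempty.
\<close>

definition is_tree :: "('v, 'e) serre_graph \<Rightarrow> bool" where
  "is_tree G \<longleftrightarrow>
     bidirected_digraph (und G) (bar G) \<and>
     strongly_connected (und G) \<and>
     (\<nexists>p. pre_digraph.cycle (und G) p \<and> (\<forall>e \<in> set p. bar G e \<notin> set p))"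

definition regular_tree :: "nat \<Rightarrow> ('v, 'e) serre_graph \<Rightarrow> bool" where
  "regular_tree d G \<longleftrightarrow> is_tree G \<and> (\<forall>x \<in> V G. out_degree (und G) x = d)"

definition cball_of :: "('v, 'e) serre_graph \<Rightarrow> 'v \<Rightarrow> nat \<Rightarrow> ('v, 'e) serre_graph" where
  "cball_of G x k =
     \<lparr> und = und G \<restriction> {y. \<exists>p. pre_digraph.awalk (und G) x p y \<and> length p \<le> k}, bar = bar G \<rparr>"

text \<open>
  Morphisms are pairs of a vertex map and an edge map. They are extensional, so that equality of
  morphisms is equality on the vertices and edges of the source.
\<close>

type_synonym ('v, 'e, 'w, 'f) gmap = "('v \<Rightarrow> 'w) \<times> ('e \<Rightarrow> 'f)"

definition graph_isos ::
  "('v, 'e) serre_graph \<Rightarrow> ('w, 'f) serre_graph \<Rightarrow> ('v, 'e, 'w, 'f) gmap set" where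
  "graph_isos G G' = {(\<phi>, \<psi>).
     \<phi> \<in> extensional (V G) \<and> bij_betw \<phi> (V G) (V G') \<and>
     \<psi> \<in> extensional (E G) \<and> bij_betw \<psi> (E G) (E G') \<and>
     (\<forall>e \<in> E G. tail (und G') (\<psi> e) = \<phi> (tail (und G) e) \<and>
                head (und G') (\<psi> e) = \<phi> (head (und G) e) \<and>
                bar G' (\<psi> e) = \<psi> (bar G e))}"

definition gcomp ::
  "('v, 'e) serre_graph \<Rightarrow> ('w, 'f, 'u, 'g) gmap \<Rightarrow> ('v, 'e, 'w, 'f) gmap \<Rightarrow> ('v, 'e, 'u, 'g) gmap"
where
  "gcomp G g f = (compose (V G) (fst g) (fst f), compose (E G) (snd g) (snd f))"

definition grestrict ::
  "('v, 'e) serre_graph \<Rightarrow> ('v, 'e, 'w, 'f) gmap \<Rightarrow> ('v, 'e, 'w, 'f) gmap" where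
  "grestrict G f = (restrict (fst f) (V G), restrict (snd f) (E G))"

definition ginverse ::
  "('v, 'e) serre_graph \<Rightarrow> ('w, 'f) serre_graph \<Rightarrow> ('v, 'e, 'w, 'f) gmap \<Rightarrow> ('w, 'f, 'v, 'e) gmap"
where
  "ginverse G G' f =
     (restrict (inv_into (V G) (fst f)) (V G'), restrict (inv_into (E G) (snd f)) (E G'))"

definition Aut :: "('v, 'e) serre_graph \<Rightarrow> ('v, 'e, 'v, 'e) gmap monoid" where
  "Aut G = \<lparr> carrier = graph_isos G G, monoid.mult = gcomp G,
             one = (restrict id (V G), restrict id (E G)) \<rparr>"

definition stab :: "('v, 'e, 'v, 'e) gmap set \<Rightarrow> 'v \<Rightarrow> ('v, 'e, 'v, 'e) gmap set" where
  "stab H x = {g \<in> H. fst g x = x}"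

definition locally_transitive ::
  "('v, 'e) serre_graph \<Rightarrow> ('v, 'e, 'v, 'e) gmap set \<Rightarrow> bool" where
  "locally_transitive G H \<longleftrightarrow>
     (\<forall>x \<in> V G. \<forall>e \<in> out_arcs (und G) x. \<forall>e' \<in> out_arcs (und G) x.
        \<exists>g \<in> stab H x. snd g e = e')"

definition is_inversion :: "('v, 'e) serre_graph \<Rightarrow> ('v, 'e, 'v, 'e) gmap \<Rightarrow> bool" where
  "is_inversion G g \<longleftrightarrow> g \<in> carrier (Aut G) \<and> (\<exists>e \<in> E G. snd g e = bar G e)"

definition involutive_inversion :: "('v, 'e) serre_graph \<Rightarrow> ('v, 'e, 'v, 'e) gmap \<Rightarrow> bool" where
  "involutive_inversion G g \<longleftrightarrow> is_inversion G g \<and> group.ord (Aut G) g = 2"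

definition is_labelling :: "('v, 'e) serre_graph \<Rightarrow> 'o set \<Rightarrow> ('e \<Rightarrow> 'o) \<Rightarrow> bool" where
  "is_labelling G \<Omega> l \<longleftrightarrow>
     (\<forall>x \<in> V G. bij_betw l (out_arcs (und G) x) \<Omega>) \<and> (\<forall>e \<in> E G. l (bar G e) = l e)"

definition label_isos ::
  "('v, 'e) serre_graph \<Rightarrow> ('e \<Rightarrow> 'o) \<Rightarrow> ('w, 'f) serre_graph \<Rightarrow> ('f \<Rightarrow> 'o) \<Rightarrow>
   ('v, 'e, 'w, 'f) gmap set" where
  "label_isos G l G' l' = {f \<in> graph_isos G G'. \<forall>e \<in> E G. l' (snd f e) = l e}"

text \<open>
  The labelled graph \<open>(B, lB)\<close> can serve as the model \<open>B\<^bsub>d,k\<^esub>\<close> of the labelled balls of radius \<open>k\<close>.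
  Neither the labelling of the tree nor the centre matters, since any two labelled balls of the
  same radius are isomorphic.
\<close>

definition labelled_ball_model ::
  "('v, 'e) serre_graph \<Rightarrow> 'o set \<Rightarrow> nat \<Rightarrow> ('w, 'f) serre_graph \<Rightarrow> ('f \<Rightarrow> 'o) \<Rightarrow> bool" where
  "labelled_ball_model T \<Omega> k B lB \<longleftrightarrow>
     (\<exists>l x. is_labelling T \<Omega> l \<and> x \<in> V T \<and> label_isos (cball_of T x k) l B lB \<noteq> {})"

definition ball_chart ::
  "('v, 'e) serre_graph \<Rightarrow> ('w, 'f) serre_graph \<Rightarrow> ('f \<Rightarrow> 'o) \<Rightarrow> ('e \<Rightarrow> 'o) \<Rightarrow> nat \<Rightarrow> 'v \<Rightarrow>
   ('v, 'e, 'w, 'f) gmap" where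
  "ball_chart T B lB l k x = (THE f. f \<in> label_isos (cball_of T x k) l B lB)"

definition local_action ::
  "('v, 'e) serre_graph \<Rightarrow> ('w, 'f) serre_graph \<Rightarrow> ('f \<Rightarrow> 'o) \<Rightarrow> ('e \<Rightarrow> 'o) \<Rightarrow> nat \<Rightarrow>
   ('v, 'e, 'v, 'e) gmap \<Rightarrow> 'v \<Rightarrow> ('w, 'f, 'w, 'f) gmap" where
  "local_action T B lB l k g x =
     gcomp B (gcomp (cball_of T x k) (ball_chart T B lB l k (fst g x)) g)
             (ginverse (cball_of T x k) B (ball_chart T B lB l k x))"

definition univ_group ::
  "('v, 'e) serre_graph \<Rightarrow> ('w, 'f) serre_graph \<Rightarrow> ('f \<Rightarrow> 'o) \<Rightarrow> ('e \<Rightarrow> 'o) \<Rightarrow> nat \<Rightarrow>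
   ('w, 'f, 'w, 'f) gmap set \<Rightarrow> ('v, 'e, 'v, 'e) gmap set" where
  "univ_group T B lB l k F =
     {g \<in> carrier (Aut T). \<forall>x \<in> V T. local_action T B lB l k g x \<in> F}"

text \<open>
  The actions of \<open>A \<le> Aut G\<close> on \<open>G\<close> and of \<open>A' \<le> Aut G'\<close> on \<open>G'\<close> are isomorphic: there is an
  isomorphism of graphs that is equivariant along an isomorphism of groups.
\<close>

definition action_isomorphic ::
  "('v, 'e) serre_graph \<Rightarrow> ('v, 'e, 'v, 'e) gmap set \<Rightarrow>
   ('w, 'f) serre_graph \<Rightarrow> ('w, 'f, 'w, 'f) gmap set \<Rightarrow> bool" where
  "action_isomorphic G A G' A' \<longleftrightarrow>
     (\<exists>f \<in> graph_isos G G'.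
      \<exists>\<theta> \<in> iso ((Aut G) \<lparr> carrier := A \<rparr>) ((Aut G') \<lparr> carrier := A' \<rparr>).
        \<forall>a \<in> A. gcomp G f a = gcomp G (\<theta> a) f)"

definition iso_to_local_action ::
  "('v, 'e) serre_graph \<Rightarrow> ('v, 'e, 'v, 'e) gmap set \<Rightarrow> nat \<Rightarrow>
   ('w, 'f) serre_graph \<Rightarrow> ('w, 'f, 'w, 'f) gmap set \<Rightarrow> bool" where
  "iso_to_local_action T H k B F \<longleftrightarrow>
     (\<forall>x \<in> V T. action_isomorphic (cball_of T x k) (grestrict (cball_of T x k) ` stab H x) B F)"

end

theory Submission
  imports Defs
begin

text \<open>
  Everything follows from one choice of labelling: it is chosen such that every label-preserving
  automorphism of \<open>T\<close> belongs to \<open>H\<close>.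

  To find it, let \<open>e\<close> be an edge inverted by an involution in \<open>H\<close>, with origin \<open>x0\<close>.  Local
  transitivity conjugates this involution by elements of \<open>H\<close> fixing \<open>x0\<close>, and so provides for
  every edge \<open>a\<close> with origin \<open>x0\<close> an involution \<open>t a \<in> H\<close> that inverts \<open>a\<close>
  (\<open>conjugate_inversion\<close>).  The group generated by the \<open>t a\<close> acts simply transitively on the
  vertices.  It is transitive because \<open>t a\<close> moves \<open>x0\<close> to the other end of \<open>a\<close>.  It is free because
  a word in the \<open>t a\<close> traces a walk that starts at \<open>x0\<close> and backtracks only where the word
  repeats a letter; since \<open>t a\<close> is an involution, repeated letters cancel, and a closed walk
  without backtracking in a tree is empty (\<open>word_act_free\<close>).  Consequently a bijection from the edges
  at \<open>x0\<close> to \<open>\<Omega>\<close> extends along the orbits of this group to a labelling of \<open>T\<close>.  An automorphism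
  that preserves the labels is determined by the image of one vertex, so that the group consists
  of all of them (\<open>label_autos_subset\<close>).

  For \<open>F k\<close> take the set of all \<open>k\<close>-local actions of elements of \<open>H\<close>; this makes
  \<open>H \<le> U k (F k)\<close> immediate.  Local actions satisfy a cocycle identity and are trivial for
  label-preserving automorphisms.  The latter are transitive on the vertices and lie in \<open>H\<close>, hence
  multiplying by them on both sides shows that for any vertex \<open>x\<close> the stabilizer of \<open>x\<close> in \<open>H\<close>
  realizes all of \<open>F k\<close> at \<open>x\<close> (\<open>local_actions_stab\<close>).  On the stabilizer the cocycle is a homomorphism, and its
  kernel acts trivially on the ball; this gives that \<open>F k\<close> is a group and the isomorphism of
  actions.  The groups \<open>U k (F k)\<close> decrease because the action on a ball determines the action on the
  smaller concentric ball, and an automorphism with trivial \<open>1\<close>-local actions preserves the labels.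

  All this rests on the fact that two labelled balls of the same radius are isomorphic by exactly
  one label-preserving isomorphism (\<open>label_iso_exists\<close>, \<open>chart_unique\<close>).
\<close>

section \<open>Isomorphisms of graphs\<close>

definition wf_serre_graph :: "('v, 'e) serre_graph \<Rightarrow> bool" where
  "wf_serre_graph G \<longleftrightarrow>
     (\<forall>e \<in> E G. tail (und G) e \<in> V G \<and> head (und G) e \<in> V G \<and> bar G e \<in> E G)"

abbreviation gid :: "('v, 'e) serre_graph \<Rightarrow> ('v, 'e, 'v, 'e) gmap" where
  "gid G \<equiv> (restrict id (V G), restrict id (E G))"

lemma gcomp_apply [simp]:
  "v \<in> V G \<Longrightarrow> fst (gcomp G g f) v = fst g (fst f v)"
  "e \<in> E G \<Longrightarrow> snd (gcomp G g f) e = snd g (snd f e)"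
  by (simp_all add: gcomp_def compose_def)

lemma grestrict_apply [simp]:
  "v \<in> V G \<Longrightarrow> fst (grestrict G f) v = fst f v"
  "e \<in> E G \<Longrightarrow> snd (grestrict G f) e = snd f e"
  by (simp_all add: grestrict_def)

lemma graph_isos_verts: "f \<in> graph_isos G G' \<Longrightarrow> v \<in> V G \<Longrightarrow> fst f v \<in> V G'"
  by (auto simp: graph_isos_def dest: bij_betwE)

lemma graph_isos_arcs: "f \<in> graph_isos G G' \<Longrightarrow> e \<in> E G \<Longrightarrow> snd f e \<in> E G'"
  by (auto simp: graph_isos_def dest: bij_betwE)

lemma graph_isos_morphism:
  assumes "f \<in> graph_isos G G'" "e \<in> E G"
  shows "tail (und G') (snd f e) = fst f (tail (und G) e)"
    and "head (und G') (snd f e) = fst f (head (und G) e)"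
    and "bar G' (snd f e) = snd f (bar G e)"
  using assms by (auto simp: graph_isos_def)

lemma graph_isos_bij:
  assumes "f \<in> graph_isos G G'"
  shows "bij_betw (fst f) (V G) (V G')" and "bij_betw (snd f) (E G) (E G')"
  using assms by (auto simp: graph_isos_def)

lemma graph_isos_inj:
  assumes "f \<in> graph_isos G G'"
  shows "v \<in> V G \<Longrightarrow> w \<in> V G \<Longrightarrow> fst f v = fst f w \<longleftrightarrow> v = w"
    and "e \<in> E G \<Longrightarrow> e' \<in> E G \<Longrightarrow> snd f e = snd f e' \<longleftrightarrow> e = e'"
  using graph_isos_bij[OF assms] by (auto simp: bij_betw_def inj_on_eq_iff)

lemma graph_isosI:
  assumes "fst f \<in> extensional (V G)" "bij_betw (fst f) (V G) (V G')"
    and "snd f \<in> extensional (E G)" "bij_betw (snd f) (E G) (E G')"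
    and "\<And>e. e \<in> E G \<Longrightarrow> tail (und G') (snd f e) = fst f (tail (und G) e)"
    and "\<And>e. e \<in> E G \<Longrightarrow> head (und G') (snd f e) = fst f (head (und G) e)"
    and "\<And>e. e \<in> E G \<Longrightarrow> bar G' (snd f e) = snd f (bar G e)"
  shows "f \<in> graph_isos G G'"
  using assms by (auto simp: graph_isos_def split: prod.splits)

lemma gmap_eqI:
  assumes "f \<in> graph_isos G G'" "f' \<in> graph_isos G G''"
    and "\<And>v. v \<in> V G \<Longrightarrow> fst f v = fst f' v"
    and "\<And>e. e \<in> E G \<Longrightarrow> snd f e = snd f' e"
  shows "f = f'"
proof (rule prod_eqI)
  show "fst f = fst f'"
    by (rule extensionalityI[where A = "V G"]) (use assms in \<open>auto simp: graph_isos_def\<close>)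
  show "snd f = snd f'"
    by (rule extensionalityI[where A = "E G"]) (use assms in \<open>auto simp: graph_isos_def\<close>)
qed

lemma gid_isos: "wf_serre_graph G \<Longrightarrow> gid G \<in> graph_isos G G"
  by (rule graph_isosI) (auto simp: wf_serre_graph_def bij_betw_def inj_on_def)

lemma gcomp_isos:
  assumes "wf_serre_graph G" "f \<in> graph_isos G G'" "g \<in> graph_isos G' G''"
  shows "gcomp G g f \<in> graph_isos G G''"
proof (rule graph_isosI)
  show "fst (gcomp G g f) \<in> extensional (V G)" "snd (gcomp G g f) \<in> extensional (E G)"
    by (auto simp: gcomp_def compose_def)
  have "bij_betw (fst g \<circ> fst f) (V G) (V G'')" "bij_betw (snd g \<circ> snd f) (E G) (E G'')"
    using assms(2,3) by (auto intro: bij_betw_trans dest: graph_isos_bij)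
  then show "bij_betw (fst (gcomp G g f)) (V G) (V G'')" "bij_betw (snd (gcomp G g f)) (E G) (E G'')"
    by (auto cong: bij_betw_cong)
qed (use assms in \<open>auto simp: wf_serre_graph_def graph_isos_morphism graph_isos_arcs graph_isos_verts\<close>)

lemma gcomp_assoc:
  assumes "f \<in> graph_isos G G'"
  shows "gcomp G h (gcomp G g f) = gcomp G (gcomp G' h g) f"
  using assms by (auto simp: gcomp_def compose_def graph_isos_verts graph_isos_arcs)

lemma gcomp_gid_right: "f \<in> graph_isos G G' \<Longrightarrow> gcomp G f (gid G) = f"
  by (auto simp: gcomp_def compose_def graph_isos_def extensional_def)

lemma gcomp_gid_left: "f \<in> graph_isos G G' \<Longrightarrow> gcomp G (gid G') f = f"
  using graph_isos_verts[of f G G'] graph_isos_arcs[of f G G']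
  by (auto simp: gcomp_def compose_def graph_isos_def extensional_def restrict_def fun_eq_iff)

lemma ginverse_apply:
  assumes "f \<in> graph_isos G G'"
  shows "v \<in> V G \<Longrightarrow> fst (ginverse G G' f) (fst f v) = v"
    and "e \<in> E G \<Longrightarrow> snd (ginverse G G' f) (snd f e) = e"
  using assms graph_isos_bij[OF assms]
  by (auto simp: ginverse_def graph_isos_verts graph_isos_arcs bij_betw_def)

lemma graph_isos_surj:
  assumes "f \<in> graph_isos G G'"
  shows "w \<in> V G' \<Longrightarrow> \<exists>v \<in> V G. w = fst f v" and "e \<in> E G' \<Longrightarrow> \<exists>e' \<in> E G. e = snd f e'"
  using graph_isos_bij[OF assms] by (auto simp: bij_betw_def)

lemma ginverse_isos:
  assumes "wf_serre_graph G" "f \<in> graph_isos G G'"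
  shows "ginverse G G' f \<in> graph_isos G' G"
proof (rule graph_isosI)
  show "fst (ginverse G G' f) \<in> extensional (V G')" "snd (ginverse G G' f) \<in> extensional (E G')"
    by (auto simp: ginverse_def)
  have "bij_betw (inv_into (V G) (fst f)) (V G') (V G)" "bij_betw (inv_into (E G) (snd f)) (E G') (E G)"
    using assms(2) by (auto intro: bij_betw_inv_into dest: graph_isos_bij)
  then show "bij_betw (fst (ginverse G G' f)) (V G') (V G)" "bij_betw (snd (ginverse G G' f)) (E G') (E G)"
    by (auto simp: ginverse_def cong: bij_betw_cong)
next
  fix e assume "e \<in> E G'"
  then obtain e' where e': "e' \<in> E G" "e = snd f e'"
    using graph_isos_surj[OF assms(2)] by blast
  then show "tail (und G) (snd (ginverse G G' f) e) = fst (ginverse G G' f) (tail (und G') e)"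
    and "head (und G) (snd (ginverse G G' f) e) = fst (ginverse G G' f) (head (und G') e)"
    and "bar G (snd (ginverse G G' f) e) = snd (ginverse G G' f) (bar G' e)"
    using assms by (auto simp: wf_serre_graph_def graph_isos_morphism ginverse_apply)
qed

lemma gcomp_ginverse_left:
  assumes "wf_serre_graph G" "f \<in> graph_isos G G'"
  shows "gcomp G (ginverse G G' f) f = gid G"
  by (rule gmap_eqI[OF gcomp_isos gid_isos])
    (use assms in \<open>auto intro: ginverse_isos simp: ginverse_apply\<close>)

lemma wf_serre_graph_transfer:
  assumes "wf_serre_graph G" "f \<in> graph_isos G G'"
  shows "wf_serre_graph G'"
  unfolding wf_serre_graph_def
proof
  fix e assume "e \<in> E G'"
  then obtain e' where e': "e' \<in> E G" "e = snd f e'"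
    using graph_isos_surj[OF assms(2)] by blast
  then show "tail (und G') e \<in> V G' \<and> head (und G') e \<in> V G' \<and> bar G' e \<in> E G'"
    using assms by (auto simp: wf_serre_graph_def graph_isos_morphism graph_isos_verts graph_isos_arcs)
qed

lemma gcomp_ginverse_right:
  assumes "wf_serre_graph G" "f \<in> graph_isos G G'"
  shows "gcomp G' f (ginverse G G' f) = gid G'"
proof (rule gmap_eqI[OF gcomp_isos gid_isos])
  show "wf_serre_graph G'" by (rule wf_serre_graph_transfer[OF assms])
  then show "wf_serre_graph G'" .
qed (use assms graph_isos_surj[OF assms(2)] in
      \<open>fastforce intro: ginverse_isos simp: ginverse_apply\<close>)+

lemma group_Aut:
  assumes "wf_serre_graph G"
  shows "group (Aut G)"
proof (rule groupI)
  fix f assume "f \<in> carrier (Aut G)"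
  with assms show "\<exists>g \<in> carrier (Aut G). g \<otimes>\<^bsub>Aut G\<^esub> f = \<one>\<^bsub>Aut G\<^esub>"
    by (auto simp: Aut_def intro!: bexI[of _ "ginverse G G f"] gcomp_ginverse_left ginverse_isos)
qed (use assms in \<open>auto simp: Aut_def intro: gid_isos gcomp_isos gcomp_gid_left
        gcomp_assoc[symmetric]\<close>)

lemma label_isosD:
  assumes "f \<in> label_isos G l G' l'"
  shows "f \<in> graph_isos G G'" and "e \<in> E G \<Longrightarrow> l' (snd f e) = l e"
  using assms by (auto simp: label_isos_def)

lemma gcomp_label_isos:
  assumes "wf_serre_graph G" "f \<in> label_isos G l G' l'" "g \<in> label_isos G' l' G'' l''"
  shows "gcomp G g f \<in> label_isos G l G'' l''"
  using assms by (auto simp: label_isos_def gcomp_isos graph_isos_arcs)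

lemma ginverse_label_isos:
  assumes "wf_serre_graph G" "f \<in> label_isos G l G' l'"
  shows "ginverse G G' f \<in> label_isos G' l' G l"
  unfolding label_isos_def
proof (intro CollectI conjI ballI)
  show "ginverse G G' f \<in> graph_isos G' G"
    using assms by (intro ginverse_isos) (auto simp: label_isos_def)
  fix e assume "e \<in> E G'"
  then obtain e' where "e' \<in> E G" "e = snd f e'"
    using graph_isos_surj[OF label_isosD(1)[OF assms(2)]] by blast
  then show "l (snd (ginverse G G' f) e) = l' e"
    using assms by (auto simp: label_isos_def ginverse_apply)
qed

lemma gid_label_isos: "wf_serre_graph G \<Longrightarrow> gid G \<in> label_isos G l G l"
  by (auto simp: label_isos_def gid_isos)

section \<open>Closed walks in trees\<close>

locale serre_tree =
  fixes T :: "('v, 'e) serre_graph"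
  assumes tree: "is_tree T"

sublocale serre_tree \<subseteq> bidirected_digraph "und T" "bar T"
  using tree by (simp add: is_tree_def)

context serre_tree
begin

lemma wf_tree: "wf_serre_graph T"
  by (simp add: wf_serre_graph_def)

abbreviation nonbacktracking :: "'e list \<Rightarrow> bool" where
  "nonbacktracking \<equiv> successively (\<lambda>e f. f \<noteq> bar T e)"

text \<open>
  In a shortest counterexample no proper nonempty subwalk is closed.  Therefore no vertex is visited
  twice, and an edge cannot occur together with its inverse, as the piece between them would be
  closed.  Such a walk is a circuit, which a tree does not have.
\<close>

lemma closed_nonbacktracking_walk_empty:
  assumes "awalk u p u" and "nonbacktracking p"
  shows "p = []"
  using assms
proof (induction p arbitrary: u rule: length_induct)
  case (1 p)
  have subwalk: "r = []" if "p = q @ r @ s" "awalk w r w" "length r < length p" for q r s w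
  proof -
    have "nonbacktracking r"
      using 1(3) that(1) by (simp add: successively_append_iff)
    with 1(1)[rule_format, OF that(3,2)] show ?thesis .
  qed
  show ?case
  proof (rule ccontr)
    assume "p \<noteq> []"
    then obtain e q where p: "p = e # q" by (cases p) auto
    have "distinct (awalk_verts (head (und T) e) q)"
    proof (rule ccontr)
      assume not_distinct: "\<not> ?thesis"
      have "awalk (head (und T) e) q u"
        using 1(2) unfolding p awalk_Cons_iff by blast
      from awalk_not_distinct_decomp[OF this not_distinct]
      obtain a r s w where "q = a @ r @ s" "0 < length r" "awalk w r w"
        by blast
      with subwalk[of "e # a" r s w] p show False by simp
    qed
    then have "cycle p"
      using 1(2) p unfolding cycle_def by (intro exI[of _ u]) simp
    then obtain f where f: "f \<in> set p" "bar T f \<in> set p"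
      using tree unfolding is_tree_def by blast
    then have f_arc: "f \<in> E T" using 1(2) unfolding awalk_def by blast
    \<comment> \<open>The two orders of \<open>f\<close> and \<open>bar T f\<close> in \<open>p\<close> differ only in which of them is called \<open>g\<close>.\<close>
    obtain g a b c where g: "g \<in> E T" "p = a @ g # b @ bar T g # c"
    proof -
      obtain xs ys where p2: "p = xs @ f # ys"
        using split_list[OF f(1)] by blast
      with f(2) arev_neq[OF f_arc] have "bar T f \<in> set xs \<or> bar T f \<in> set ys"
        by auto
      then show thesis
      proof
        assume "bar T f \<in> set xs"
        then obtain xs1 xs2 where "xs = xs1 @ bar T f # xs2"
          using split_list by metis
        then have "p = xs1 @ bar T f # xs2 @ bar T (bar T f) # ys"
          using p2 by simp
        then show thesis by (rule that[OF arev_in_arcs[OF f_arc]])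
      next
        assume "bar T f \<in> set ys"
        then obtain ys1 ys2 where "ys = ys1 @ bar T f # ys2"
          using split_list by metis
        then have "p = xs @ f # ys1 @ bar T f # ys2" using p2 by simp
        then show thesis by (rule that[OF f_arc])
      qed
    qed
    have "awalk (head (und T) g) b (head (und T) g)"
      using 1(2) unfolding g(2) awalk_append_iff awalk_Cons_iff by (simp add: g(1)) metis
    then have "b = []"
      using subwalk[of "a @ [g]" b "bar T g # c"] g by simp
    then show False
      using 1(3) g by (simp add: successively_append_iff)
  qed
qed

lemma not_successively_neqD:
  assumes "\<not> successively (\<noteq>) w"
  shows "\<exists>u a v. w = u @ [a, a] @ v"
  using assms
proof (induction w)
  case (Cons a w)
  show ?case
  proof (cases "successively (\<noteq>) w")
    case True
    then obtain v where "w = a # v"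
      using Cons.prems by (cases w) auto
    then have "a # w = [] @ [a, a] @ v" by simp
    then show ?thesis by blast
  next
    case False
    then obtain u b v where "w = u @ [b, b] @ v" using Cons.IH by blast
    then have "a # w = (a # u) @ [b, b] @ v" by simp
    then show ?thesis by blast
  qed
qed simp

section \<open>Walks described by labels\<close>

declare in_lists_conv_set [simp] ball_Un [simp]

text \<open>
  Given a labelling, a vertex and a list of labels describe a walk: each label selects one of
  the edges at the current vertex.  Labels are invariant under inversion of edges, so a repeated
  letter in the list goes along an edge and back.
\<close>

definition arc_at :: "('e \<Rightarrow> 'o) \<Rightarrow> 'v \<Rightarrow> 'o \<Rightarrow> 'e" where
  "arc_at l x a = (THE e. e \<in> out_arcs (und T) x \<and> l e = a)"

fun walk :: "('e \<Rightarrow> 'o) \<Rightarrow> 'v \<Rightarrow> 'o list \<Rightarrow> 'e list" where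
  "walk l x [] = []"
| "walk l x (a # w) = arc_at l x a # walk l (head (und T) (arc_at l x a)) w"

fun endpoint :: "('e \<Rightarrow> 'o) \<Rightarrow> 'v \<Rightarrow> 'o list \<Rightarrow> 'v" where
  "endpoint l x [] = x"
| "endpoint l x (a # w) = endpoint l (head (und T) (arc_at l x a)) w"

lemma labelling_bar: "is_labelling T \<Omega> l \<Longrightarrow> e \<in> E T \<Longrightarrow> l (bar T e) = l e"
  by (simp add: is_labelling_def)

lemma labelling_in: "is_labelling T \<Omega> l \<Longrightarrow> e \<in> E T \<Longrightarrow> l e \<in> \<Omega>"
  using bij_betwE[of l "out_arcs (und T) (tail (und T) e)" \<Omega>] by (simp add: is_labelling_def)

lemma labelling_inj:
  assumes "is_labelling T \<Omega> l" "e \<in> E T" "e' \<in> E T"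
    and "tail (und T) e = tail (und T) e'" "l e = l e'"
  shows "e = e'"
proof -
  have "inj_on l (out_arcs (und T) (tail (und T) e))"
    using assms(1,2) by (auto simp: is_labelling_def bij_betw_def)
  then show ?thesis
    by (rule inj_onD) (use assms in auto)
qed

lemma arc_at_eq:
  assumes "is_labelling T \<Omega> l" "e \<in> E T"
  shows "arc_at l (tail (und T) e) (l e) = e"
  unfolding arc_at_def
  by (rule the_equality) (use assms labelling_inj[OF assms(1)] in auto)

lemma arc_at:
  assumes "is_labelling T \<Omega> l" "x \<in> V T" "a \<in> \<Omega>"
  shows "arc_at l x a \<in> E T" "tail (und T) (arc_at l x a) = x" "l (arc_at l x a) = a"
proof -
  have "a \<in> l ` out_arcs (und T) x"
    using assms by (auto simp: is_labelling_def bij_betw_def)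
  then obtain e where e: "e \<in> E T" "tail (und T) e = x" "l e = a" by auto
  with arc_at_eq[OF assms(1) e(1)] show "arc_at l x a \<in> E T"
      "tail (und T) (arc_at l x a) = x" "l (arc_at l x a) = a"
    by auto
qed

lemma awalk_walk:
  assumes "is_labelling T \<Omega> l" "x \<in> V T" "w \<in> lists \<Omega>"
  shows "awalk x (walk l x w) (endpoint l x w)"
  using assms(2,3)
  by (induction w arbitrary: x) (auto simp: awalk_Nil_iff awalk_Cons_iff arc_at[OF assms(1)])

lemma endpoint_in:
  assumes "is_labelling T \<Omega> l" "x \<in> V T" "w \<in> lists \<Omega>"
  shows "endpoint l x w \<in> V T"
  using awalk_walk[OF assms] by (rule awalk_last_in_verts)

lemma length_walk [simp]: "length (walk l x w) = length w"
  by (induction w arbitrary: x) auto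

lemma endpoint_append [simp]: "endpoint l x (u @ w) = endpoint l (endpoint l x u) w"
  by (induction u arbitrary: x) auto

lemma arc_at_head:
  assumes "is_labelling T \<Omega> l" "x \<in> V T" "a \<in> \<Omega>"
  shows "arc_at l (head (und T) (arc_at l x a)) a = bar T (arc_at l x a)"
  using arc_at_eq[OF assms(1), of "bar T (arc_at l x a)"] arc_at[OF assms]
  by (simp add: labelling_bar[OF assms(1)])

lemma endpoint_square:
  assumes "is_labelling T \<Omega> l" "x \<in> V T" "a \<in> \<Omega>"
  shows "endpoint l x [a, a] = x"
  using arc_at[OF assms] by (simp add: arc_at_head[OF assms])

lemma endpoint_cancel:
  assumes "is_labelling T \<Omega> l" "x \<in> V T" "u \<in> lists \<Omega>" "a \<in> \<Omega>"
  shows "endpoint l x (u @ [a, a] @ v) = endpoint l x (u @ v)"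
  using endpoint_square[OF assms(1) endpoint_in[OF assms(1-3)] assms(4)] by simp

lemma endpoint_rev:
  assumes "is_labelling T \<Omega> l" "x \<in> V T" "w \<in> lists \<Omega>"
  shows "endpoint l (endpoint l x w) (rev w) = x"
  using assms(2,3)
proof (induction w arbitrary: x)
  case (Cons a w)
  then show ?case
    using arc_at[OF assms(1), of x a] endpoint_square[OF assms(1), of x a] by simp
qed simp

lemma walk_of_awalk:
  assumes "is_labelling T \<Omega> l" "awalk x p y"
  shows "endpoint l x (map l p) = y" and "map l p \<in> lists \<Omega>"
proof -
  show "endpoint l x (map l p) = y"
    using assms(2)
    by (induction p arbitrary: x)
      (auto simp: awalk_Nil_iff awalk_Cons_iff arc_at_eq[OF assms(1)])
  show "map l p \<in> lists \<Omega>"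
    using assms(2) labelling_in[OF assms(1)] unfolding awalk_def by (auto dest: subsetD)
qed

lemma nonbacktracking_walk:
  assumes "is_labelling T \<Omega> l" "x \<in> V T" "w \<in> lists \<Omega>" "successively (\<noteq>) w"
  shows "nonbacktracking (walk l x w)"
  using assms(2,3,4)
proof (induction w arbitrary: x rule: induct_list012)
  case (3 a b w)
  then have ab: "a \<in> \<Omega>" "b \<in> \<Omega>" "a \<noteq> b" "b # w \<in> lists \<Omega>" "successively (\<noteq>) (b # w)"
    by simp_all
  note a = arc_at[OF assms(1) 3(3) ab(1)]
  let ?y = "head (und T) (arc_at l x a)"
  have y: "?y \<in> V T" using a(1) by simp
  have "arc_at l ?y b \<noteq> bar T (arc_at l x a)"
  proof
    assume "arc_at l ?y b = bar T (arc_at l x a)"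
    then have "l (arc_at l ?y b) = l (arc_at l x a)"
      using labelling_bar[OF assms(1) a(1)] by simp
    then show False
      using a(3) arc_at(3)[OF assms(1) y ab(2)] ab(3) by simp
  qed
  moreover have "nonbacktracking (walk l ?y (b # w))"
    by (rule 3(2)[OF y ab(4,5)])
  ultimately show ?case
    by (simp only: walk.simps successively.simps simp_thms)
qed simp_all

text \<open>
  The walk of a word without repeated letters does not backtrack.  Together with
  \<open>endpoint_cancel\<close> this makes words modulo cancellation of squares a model of the vertex set.
\<close>

lemma reduced_closed_word_empty:
  assumes "is_labelling T \<Omega> l" "x \<in> V T" "w \<in> lists \<Omega>" "successively (\<noteq>) w"
    and "endpoint l x w = x"
  shows "w = []"
proof -
  have "awalk x (walk l x w) x"
    using awalk_walk[OF assms(1-3)] assms(5) by simp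
  then have "walk l x w = []"
    using nonbacktracking_walk[OF assms(1-4)] by (rule closed_nonbacktracking_walk_empty)
  then have "length (walk l x w) = 0" by simp
  then show ?thesis by simp
qed

text \<open>
  Whether a word returns to its start is decided by cancelling squares \<open>[a, a]\<close> alone, which is
  insensitive to the vertex and to the labelling.
\<close>

lemma closed_word_closed:
  assumes "is_labelling T \<Omega> l" "is_labelling T \<Omega> l'" "x \<in> V T" "x' \<in> V T" "w \<in> lists \<Omega>"
    and "endpoint l x w = x"
  shows "endpoint l' x' w = x'"
  using assms(5,6)
proof (induction w rule: length_induct)
  case (1 w)
  show ?case
  proof (cases "successively (\<noteq>) w")
    case True
    with reduced_closed_word_empty[OF assms(1,3) 1(2) True 1(3)] show ?thesis by simp
  next
    case False
    then obtain u a v where w: "w = u @ [a, a] @ v"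
      using not_successively_neqD by blast
    with 1(2) have uav: "u \<in> lists \<Omega>" "a \<in> \<Omega>" "v \<in> lists \<Omega>" by auto
    have "endpoint l x (u @ v) = x"
      using endpoint_cancel[OF assms(1,3) uav(1,2)] 1(3) w by metis
    then have "endpoint l' x' (u @ v) = x'"
      using 1(1)[rule_format, of "u @ v"] uav w by simp
    then show ?thesis
      using endpoint_cancel[OF assms(2,4) uav(1,2)] w by metis
  qed
qed

text \<open>
  Two words end at the same vertex exactly if the first followed by the reverse of the second is
  closed.
\<close>

lemma same_endpoint_transfer:
  assumes "is_labelling T \<Omega> l" "is_labelling T \<Omega> l'" "x \<in> V T" "x' \<in> V T"
    and "u \<in> lists \<Omega>" "w \<in> lists \<Omega>" and "endpoint l x u = endpoint l x w"
  shows "endpoint l' x' u = endpoint l' x' w"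
proof -
  have "endpoint l x (u @ rev w) = x"
    using assms(7) endpoint_rev[OF assms(1,3,6)] by simp
  then have "endpoint l' x' (u @ rev w) = x'"
    using closed_word_closed[OF assms(1-4), of "u @ rev w"] assms(5,6) by simp
  then show ?thesis
    using endpoint_rev[OF assms(2) endpoint_in[OF assms(2,4,5)], of "rev w"] assms(6) by simp
qed

lemma word_exists:
  assumes "is_labelling T \<Omega> l" "x \<in> V T" "y \<in> V T"
  shows "\<exists>w \<in> lists \<Omega>. endpoint l x w = y"
proof -
  have "x \<rightarrow>\<^sup>*\<^bsub>und T\<^esub> y"
    using tree assms by (auto simp: is_tree_def strongly_connected_def)
  then obtain p where "awalk x p y" by (auto simp: reachable_awalk)
  with walk_of_awalk[OF assms(1)] show ?thesis by blast
qed

text \<open>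
  The isomorphism sends the end of the walk with word \<open>w\<close> from \<open>x\<close> to the end of the walk with
  word \<open>w\<close> from \<open>x'\<close>.  By \<open>same_endpoint_transfer\<close> this does not depend on the word, and, with
  the roles of the labellings exchanged, it is injective.
\<close>

lemma label_iso_exists:
  assumes l: "is_labelling T \<Omega> l" and l': "is_labelling T \<Omega> l'"
    and x: "x \<in> V T" and x': "x' \<in> V T"
  shows "\<exists>f \<in> label_isos T l T l'. fst f x = x'"
proof -
  define word where "word y = (SOME w. w \<in> lists \<Omega> \<and> endpoint l x w = y)" for y
  have word: "word y \<in> lists \<Omega>" "endpoint l x (word y) = y" if "y \<in> V T" for y
    using someI_ex[of "\<lambda>w. w \<in> lists \<Omega> \<and> endpoint l x w = y"] word_exists[OF l x that]
    by (auto simp: word_def)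
  define \<phi> where "\<phi> = restrict (\<lambda>y. endpoint l' x' (word y)) (V T)"
  define \<psi> where "\<psi> = restrict (\<lambda>e. arc_at l' (\<phi> (tail (und T) e)) (l e)) (E T)"
  have \<phi>: "\<phi> (endpoint l x w) = endpoint l' x' w" if "w \<in> lists \<Omega>" for w
    using same_endpoint_transfer[OF l l' x x' _ that, of "word (endpoint l x w)"]
      word[OF endpoint_in[OF l x that]] endpoint_in[OF l x that] by (simp add: \<phi>_def)
  have \<phi>_in: "\<phi> y \<in> V T" if "y \<in> V T" for y
    using endpoint_in[OF l' x'] word[OF that] that by (simp add: \<phi>_def)
  have \<psi>: "\<psi> e \<in> E T" "tail (und T) (\<psi> e) = \<phi> (tail (und T) e)" "l' (\<psi> e) = l e"
    if "e \<in> E T" for e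
    using arc_at[OF l' \<phi>_in] that labelling_in[OF l that] by (auto simp: \<psi>_def)
  have head_\<psi>: "head (und T) (\<psi> e) = \<phi> (head (und T) e)" if e: "e \<in> E T" for e
  proof -
    let ?w = "word (tail (und T) e)"
    have w: "?w \<in> lists \<Omega>" "endpoint l x ?w = tail (und T) e"
      using word[of "tail (und T) e"] e by auto
    have we: "?w @ [l e] \<in> lists \<Omega>" using w labelling_in[OF l e] by simp
    have "endpoint l x (?w @ [l e]) = head (und T) e"
      using w arc_at_eq[OF l e] by simp
    moreover have "endpoint l' x' (?w @ [l e]) = head (und T) (\<psi> e)"
      using \<phi>[OF w(1)] w e by (simp add: \<psi>_def)
    ultimately show ?thesis using \<phi>[OF we] by simp
  qed
  have inj_\<phi>: "y = z" if "y \<in> V T" "z \<in> V T" "\<phi> y = \<phi> z" for y z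
    using same_endpoint_transfer[OF l' l x' x word(1) word(1)] word that by (simp add: \<phi>_def)
  have surj_\<phi>: "\<exists>y \<in> V T. \<phi> y = z" if "z \<in> V T" for z
    using word_exists[OF l' x' that] \<phi> endpoint_in[OF l x] by blast
  have "(\<phi>, \<psi>) \<in> graph_isos T T"
  proof (rule graph_isosI; simp only: fst_conv snd_conv)
    show "\<phi> \<in> extensional (V T)" "\<psi> \<in> extensional (E T)"
      by (simp_all add: \<phi>_def \<psi>_def)
    show "bij_betw \<phi> (V T) (V T)"
      unfolding bij_betw_def inj_on_def using inj_\<phi> surj_\<phi> \<phi>_in by blast
    show "bij_betw \<psi> (E T) (E T)"
      unfolding bij_betw_def
    proof (intro conjI inj_onI subset_antisym subsetI)
      fix e e' assume e: "e \<in> E T" "e' \<in> E T" "\<psi> e = \<psi> e'"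
      then have "tail (und T) e = tail (und T) e'" "l e = l e'"
        using \<psi>(2,3)[OF e(1)] \<psi>(2,3)[OF e(2)] inj_\<phi>[of "tail (und T) e" "tail (und T) e'"]
        by simp_all
      then show "e = e'" using labelling_inj[OF l] e by blast
    next
      fix e assume e: "e \<in> E T"
      then obtain y where y: "y \<in> V T" "\<phi> y = tail (und T) e"
        using surj_\<phi>[of "tail (und T) e"] by auto
      let ?e = "arc_at l y (l' e)"
      note a = arc_at[OF l y(1) labelling_in[OF l' e]]
      have "\<psi> ?e = e"
        using labelling_inj[OF l' \<psi>(1)[OF a(1)] e] \<psi>[OF a(1)] a y by simp
      then show "e \<in> \<psi> ` E T" using imageI[OF a(1), of \<psi>] by simp
    qed (use \<psi> in auto)
  next
    fix e assume e: "e \<in> E T"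
    show "tail (und T) (\<psi> e) = \<phi> (tail (und T) e)" using \<psi>(2) e by simp
    show "head (und T) (\<psi> e) = \<phi> (head (und T) e)" using head_\<psi> e by simp
    show "bar T (\<psi> e) = \<psi> (bar T e)"
    proof (rule labelling_inj[OF l'])
      show "l' (bar T (\<psi> e)) = l' (\<psi> (bar T e))"
        using \<psi> e by (simp add: labelling_bar[OF l] labelling_bar[OF l'])
    qed (use \<psi> e head_\<psi> in auto)
  qed
  moreover have "\<phi> x = x'" using \<phi>[of "[]"] by simp
  ultimately show ?thesis
    using \<psi>(3) by (intro bexI[of _ "(\<phi>, \<psi>)"]) (auto simp: label_isos_def)
qed

section \<open>Balls and the rigidity of labelled balls\<close>

lemma verts_ball: "V (cball_of T x k) = {y. \<exists>p. awalk x p y \<and> length p \<le> k}"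
  by (simp add: cball_of_def)

lemma arcs_ball:
  "E (cball_of T x k) =
     {e \<in> E T. tail (und T) e \<in> V (cball_of T x k) \<and> head (und T) e \<in> V (cball_of T x k)}"
  by (simp add: cball_of_def)

lemma ball_simps [simp]:
  "tail (und (cball_of T x k)) = tail (und T)"
  "head (und (cball_of T x k)) = head (und T)"
  "bar (cball_of T x k) = bar T"
  by (simp_all add: cball_of_def)

lemma wf_ball: "wf_serre_graph (cball_of T x k)"
  by (auto simp: wf_serre_graph_def arcs_ball)

lemma verts_ball_subset: "V (cball_of T x k) \<subseteq> V T"
  by (auto simp: verts_ball)

lemma arcs_ball_subset: "E (cball_of T x k) \<subseteq> E T"
  by (auto simp: arcs_ball)

lemma verts_ball_mono: "V (cball_of T x k) \<subseteq> V (cball_of T x (Suc k))"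
  by (auto simp: verts_ball intro: le_SucI)

lemma arcs_ball_mono: "E (cball_of T x k) \<subseteq> E (cball_of T x (Suc k))"
  using verts_ball_mono[of x k] unfolding arcs_ball by blast

lemma centre_in_ball: "x \<in> V T \<Longrightarrow> x \<in> V (cball_of T x k)"
  unfolding verts_ball by (intro CollectI exI[of _ "[]"]) (simp add: awalk_Nil_iff)

lemma out_arcs_in_ball:
  assumes "e \<in> E T" "1 \<le> k"
  shows "e \<in> E (cball_of T (tail (und T) e) k)"
proof -
  have "awalk (tail (und T) e) [e] (head (und T) e)"
    using assms by (simp add: arc_implies_awalk)
  then have "head (und T) e \<in> V (cball_of T (tail (und T) e) k)"
    using assms(2) unfolding verts_ball by (intro CollectI exI[of _ "[e]"]) simp
  then show ?thesis
    using assms centre_in_ball[OF tail_in_verts[OF assms(1)]] by (simp add: arcs_ball)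
qed

lemma verts_ball_endpoint:
  assumes "is_labelling T \<Omega> l" "x \<in> V T"
  shows "V (cball_of T x k) = {endpoint l x w | w. w \<in> lists \<Omega> \<and> length w \<le> k}"
proof (intro subset_antisym subsetI)
  fix y assume "y \<in> V (cball_of T x k)"
  then obtain p where p: "awalk x p y" "length p \<le> k" by (auto simp: verts_ball)
  then show "y \<in> {endpoint l x w | w. w \<in> lists \<Omega> \<and> length w \<le> k}"
    using walk_of_awalk[OF assms(1) p(1)] p(2) by (intro CollectI exI[of _ "map l p"]) simp
next
  fix y assume "y \<in> {endpoint l x w | w. w \<in> lists \<Omega> \<and> length w \<le> k}"
  then obtain w where "w \<in> lists \<Omega>" "length w \<le> k" "y = endpoint l x w" by blast
  then show "y \<in> V (cball_of T x k)"
    using awalk_walk[OF assms, of w]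
    unfolding verts_ball by (intro CollectI exI[of _ "walk l x w"]) simp
qed

lemma awalk_image:
  assumes "g \<in> graph_isos T T" "awalk x p y"
  shows "awalk (fst g x) (map (snd g) p) (fst g y)"
  using assms(2)
  by (induction p arbitrary: x)
    (auto simp: awalk_Nil_iff awalk_Cons_iff graph_isos_verts[OF assms(1)]
      graph_isos_arcs[OF assms(1)] graph_isos_morphism[OF assms(1)])

lemma ball_image:
  assumes "g \<in> graph_isos T T" "y \<in> V (cball_of T x k)"
  shows "fst g y \<in> V (cball_of T (fst g x) k)"
proof -
  obtain p where "awalk x p y" "length p \<le> k"
    using assms(2) by (auto simp: verts_ball)
  then show ?thesis
    using awalk_image[OF assms(1)]
    unfolding verts_ball by (intro CollectI exI[of _ "map (snd g) p"]) simp
qed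

lemma ball_image_iff:
  assumes g: "g \<in> graph_isos T T" and "x \<in> V T" "y \<in> V T"
  shows "fst g y \<in> V (cball_of T (fst g x) k) \<longleftrightarrow> y \<in> V (cball_of T x k)"
proof
  assume "fst g y \<in> V (cball_of T (fst g x) k)"
  from ball_image[OF ginverse_isos[OF wf_tree g] this] show "y \<in> V (cball_of T x k)"
    using assms by (simp add: ginverse_apply)
qed (rule ball_image[OF g])

lemma grestrict_ball:
  assumes g: "g \<in> graph_isos T T" and x: "x \<in> V T"
  shows "grestrict (cball_of T x k) g \<in> graph_isos (cball_of T x k) (cball_of T (fst g x) k)"
proof (rule graph_isosI)
  let ?A = "cball_of T x k" and ?B = "cball_of T (fst g x) k"
  show "fst (grestrict ?A g) \<in> extensional (V ?A)" "snd (grestrict ?A g) \<in> extensional (E ?A)"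
    by (auto simp: grestrict_def)
  have "bij_betw (fst g) (V ?A) (V ?B)"
    unfolding bij_betw_def
  proof
    show "inj_on (fst g) (V ?A)"
      using graph_isos_bij(1)[OF g] verts_ball_subset by (auto simp: bij_betw_def intro: inj_on_subset)
    show "fst g ` V ?A = V ?B"
    proof (intro subset_antisym subsetI)
      fix y assume y: "y \<in> V ?B"
      then obtain z where "z \<in> V T" "y = fst g z"
        using graph_isos_surj(1)[OF g] verts_ball_subset by blast
      with y show "y \<in> fst g ` V ?A" by (auto simp: ball_image_iff[OF g x])
    qed (use ball_image[OF g] in auto)
  qed
  then show "bij_betw (fst (grestrict ?A g)) (V ?A) (V ?B)"
    by (simp cong: bij_betw_cong)
  have "bij_betw (snd g) (E ?A) (E ?B)"
    unfolding bij_betw_def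
  proof
    show "inj_on (snd g) (E ?A)"
      using graph_isos_bij(2)[OF g] arcs_ball_subset by (auto simp: bij_betw_def intro: inj_on_subset)
    have iff: "snd g e \<in> E ?B \<longleftrightarrow> e \<in> E ?A" if "e \<in> E T" for e
      using that graph_isos_morphism[OF g that] graph_isos_arcs[OF g that]
      by (simp add: arcs_ball ball_image_iff[OF g x])
    show "snd g ` E ?A = E ?B"
    proof (intro subset_antisym subsetI)
      fix e assume e: "e \<in> E ?B"
      then obtain e' where "e' \<in> E T" "e = snd g e'"
        using graph_isos_surj(2)[OF g] arcs_ball_subset by blast
      with e show "e \<in> snd g ` E ?A" by (auto simp: iff)
    qed (use iff arcs_ball_subset in blast)
  qed
  then show "bij_betw (snd (grestrict ?A g)) (E ?A) (E ?B)"
    by (simp cong: bij_betw_cong)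
next
  fix e assume "e \<in> E (cball_of T x k)"
  moreover from this have "bar T e \<in> E (cball_of T x k)" "e \<in> E T"
    by (auto simp: arcs_ball)
  ultimately show "tail (und (cball_of T (fst g x) k)) (snd (grestrict (cball_of T x k) g) e) =
        fst (grestrict (cball_of T x k) g) (tail (und (cball_of T x k)) e)"
    and "head (und (cball_of T (fst g x) k)) (snd (grestrict (cball_of T x k) g) e) =
        fst (grestrict (cball_of T x k) g) (head (und (cball_of T x k)) e)"
    and "bar (cball_of T (fst g x) k) (snd (grestrict (cball_of T x k) g) e) =
        snd (grestrict (cball_of T x k) g) (bar (cball_of T x k) e)"
    using graph_isos_morphism[OF g] by (auto simp: arcs_ball)
qed

lemma grestrict_ball_label:
  assumes "g \<in> label_isos T l T l'" "x \<in> V T"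
  shows "grestrict (cball_of T x k) g \<in> label_isos (cball_of T x k) l (cball_of T (fst g x) k) l'"
  unfolding label_isos_def[of "cball_of T x k"]
proof (intro CollectI conjI ballI)
  show "grestrict (cball_of T x k) g \<in> graph_isos (cball_of T x k) (cball_of T (fst g x) k)"
    using assms by (auto intro: grestrict_ball label_isosD)
  show "l' (snd (grestrict (cball_of T x k) g) e) = l e" if "e \<in> E (cball_of T x k)" for e
    using that label_isosD(2)[OF assms(1), of e] arcs_ball_subset by auto
qed

text \<open>
  Maps defined on a ball into \<open>T\<close> and automorphisms of \<open>T\<close> are to be compared on the edges of the
  ball.  Only compatibility with tails, heads and labels on a set \<open>A\<close> of edges matters for that.
\<close>

definition label_hom :: "('e \<Rightarrow> 'o) \<Rightarrow> ('e \<Rightarrow> 'o) \<Rightarrow> 'e set \<Rightarrow> ('v, 'e, 'v, 'e) gmap \<Rightarrow> bool" where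
  "label_hom l l' A f \<longleftrightarrow> (\<forall>e \<in> A. snd f e \<in> E T \<and>
     tail (und T) (snd f e) = fst f (tail (und T) e) \<and>
     head (und T) (snd f e) = fst f (head (und T) e) \<and> l' (snd f e) = l e)"

lemma label_hom_tree:
  assumes "f \<in> label_isos T l T l'" "A \<subseteq> E T"
  shows "label_hom l l' A f"
  unfolding label_hom_def
  using assms(2) label_isosD[OF assms(1)] graph_isos_morphism[OF label_isosD(1)[OF assms(1)]]
    graph_isos_arcs[OF label_isosD(1)[OF assms(1)]] by (simp add: subset_iff)

lemma label_hom_ball:
  assumes "f \<in> label_isos (cball_of T x k) l (cball_of T y k) l'"
  shows "label_hom l l' (E (cball_of T x k)) f"
  unfolding label_hom_def
proof
  fix e assume e: "e \<in> E (cball_of T x k)"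
  note iso = label_isosD(1)[OF assms]
  show "snd f e \<in> E T \<and> tail (und T) (snd f e) = fst f (tail (und T) e) \<and>
      head (und T) (snd f e) = fst f (head (und T) e) \<and> l' (snd f e) = l e"
    using graph_isos_morphism[OF iso e] graph_isos_arcs[OF iso e] label_isosD(2)[OF assms e]
      arcs_ball_subset by auto
qed

text \<open>
  A label-preserving map carries the walk with word \<open>w\<close> to the walk with the same word, hence it is
  determined by the image of the starting point.
\<close>

lemma label_hom_endpoint:
  assumes l: "is_labelling T \<Omega> l" and l': "is_labelling T \<Omega> l'"
    and x: "x \<in> V T" and f: "label_hom l l' (E (cball_of T x k)) f"
    and "w \<in> lists \<Omega>" "length w \<le> k"
  shows "fst f (endpoint l x w) = endpoint l' (fst f x) w"
  using assms(5,6)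
proof (induction w rule: rev_induct)
  case (snoc a w)
  let ?y = "endpoint l x w"
  let ?e = "arc_at l ?y a"
  have w: "w \<in> lists \<Omega>" "a \<in> \<Omega>" using snoc.prems by auto
  note e = arc_at[OF l endpoint_in[OF l x w(1)] w(2)]
  have "?y \<in> V (cball_of T x k)"
    using w snoc.prems by (auto simp: verts_ball_endpoint[OF l x])
  moreover have "head (und T) ?e \<in> V (cball_of T x k)"
    using snoc.prems unfolding verts_ball_endpoint[OF l x]
    by (intro CollectI exI[of _ "w @ [a]"]) auto
  ultimately have "?e \<in> E (cball_of T x k)"
    using e by (simp add: arcs_ball)
  with f have fe: "snd f ?e \<in> E T" "tail (und T) (snd f ?e) = fst f ?y"
      "head (und T) (snd f ?e) = fst f (head (und T) ?e)" "l' (snd f ?e) = a"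
    using e by (auto simp: label_hom_def)
  have "arc_at l' (fst f ?y) a = snd f ?e"
    using arc_at_eq[OF l' fe(1)] fe by simp
  then show ?case
    using snoc w fe by simp
qed simp

lemma label_hom_unique:
  assumes l: "is_labelling T \<Omega> l" and l': "is_labelling T \<Omega> l'" and x: "x \<in> V T"
    and f: "label_hom l l' (E (cball_of T x k)) f"
    and f': "label_hom l l' (E (cball_of T x k)) f'"
    and "fst f x = fst f' x"
  shows "y \<in> V (cball_of T x k) \<Longrightarrow> fst f y = fst f' y"
    and "e \<in> E (cball_of T x k) \<Longrightarrow> snd f e = snd f' e"
proof -
  show verts: "fst f y = fst f' y" if "y \<in> V (cball_of T x k)" for y
    using that label_hom_endpoint[OF l l' x f] label_hom_endpoint[OF l l' x f'] assms(6)
    by (auto simp: verts_ball_endpoint[OF l x])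
  show "snd f e = snd f' e" if e: "e \<in> E (cball_of T x k)"
    by (rule labelling_inj[OF l'])
      (use e f f' verts[of "tail (und T) e"] in \<open>auto simp: label_hom_def arcs_ball\<close>)
qed

lemma label_iso_unique:
  assumes l: "is_labelling T \<Omega> l" and l': "is_labelling T \<Omega> l'" and x: "x \<in> V T"
    and f: "f \<in> label_isos T l T l'" "f' \<in> label_isos T l T l'" "fst f x = fst f' x"
  shows "f = f'"
proof (rule gmap_eqI)
  have unique: "fst f y = fst f' y" if "y \<in> V (cball_of T x k)" for y k
    using label_hom_unique(1)[OF l l' x label_hom_tree[OF f(1) arcs_ball_subset]
        label_hom_tree[OF f(2) arcs_ball_subset] f(3) that] .
  show verts: "fst f y = fst f' y" if y: "y \<in> V T" for y
  proof -
    obtain w where "w \<in> lists \<Omega>" "endpoint l x w = y"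
      using word_exists[OF l x y] by blast
    then have "y \<in> V (cball_of T x (length w))"
      by (auto simp: verts_ball_endpoint[OF l x])
    then show ?thesis by (rule unique)
  qed
  show "snd f e = snd f' e" if e: "e \<in> E T" for e
    by (rule labelling_inj[OF l'])
      (use e f label_isosD[OF f(1)] label_isosD[OF f(2)] verts[of "tail (und T) e"]
        in \<open>auto simp: graph_isos_arcs graph_isos_morphism\<close>)
qed (use f in \<open>auto dest: label_isosD\<close>)

text \<open>
  If \<open>v\<close> has a repeated letter, it can be shortened.  Otherwise the closed word \<open>u @ rev v\<close> must
  have a repeated letter where the two halves meet, and both words can be shortened by it.
\<close>

lemma reduced_word_shortest:
  assumes l: "is_labelling T \<Omega> l" and x: "x \<in> V T"
    and u: "u \<in> lists \<Omega>" "successively (\<noteq>) u"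
    and "v \<in> lists \<Omega>" "endpoint l x u = endpoint l x v"
  shows "length u \<le> length v"
  using assms(3-)
proof (induction v arbitrary: u rule: length_induct)
  case (1 v)
  show ?case
  proof (cases "successively (\<noteq>) v")
    case False
    then obtain r a s where v: "v = r @ [a, a] @ s"
      using not_successively_neqD by blast
    have "endpoint l x v = endpoint l x (r @ s)"
      using endpoint_cancel[OF l x] 1(4) v by auto
    then have "length u \<le> length (r @ s)"
      using 1 v by (intro 1(1)[rule_format, of "r @ s"]) auto
    then show ?thesis using v by simp
  next
    case reduced: True
    show ?thesis
    proof (cases "successively (\<noteq>) (u @ rev v)")
      case True
      have "endpoint l x (u @ rev v) = x"
        using 1(5) endpoint_rev[OF l x 1(4)] by simp
      then have "u @ rev v = []"
        using True 1(2,4) by (intro reduced_closed_word_empty[OF l x]) auto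
      then show ?thesis by simp
    next
      case False
      have "successively (\<lambda>a b. b \<noteq> a) v"
        using reduced by (rule successively_mono) auto
      with False have "u \<noteq> []" "v \<noteq> []" "last u = last v"
        using 1(3) by (auto simp: successively_append_iff hd_rev successively_rev)
      then obtain u' v' a where uv: "u = u' @ [a]" "v = v' @ [a]"
        by (metis append_butlast_last_id)
      then have "endpoint l x u' = endpoint l x (u @ [a])" "endpoint l x v' = endpoint l x (v @ [a])"
        using endpoint_square[OF l endpoint_in[OF l x], of _ a] 1(2,4) by auto
      then have "endpoint l x u' = endpoint l x v'" using 1(5) by simp
      moreover have "successively (\<noteq>) u'"
        using 1(3) uv by (auto simp: successively_append_iff)
      ultimately have "length u' \<le> length v'"
        using 1(1,2,4) uv by auto
      then show ?thesis using uv by simp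
    qed
  qed
qed

lemma reduced_word_exists:
  assumes l: "is_labelling T \<Omega> l" and x: "x \<in> V T" and y: "y \<in> V T"
  shows "\<exists>w \<in> lists \<Omega>. successively (\<noteq>) w \<and> endpoint l x w = y"
proof -
  obtain w where w: "w \<in> lists \<Omega> \<and> endpoint l x w = y"
    and least: "\<forall>v. v \<in> lists \<Omega> \<and> endpoint l x v = y \<longrightarrow> length w \<le> length v"
    using ex_has_least_nat[of "\<lambda>w. w \<in> lists \<Omega> \<and> endpoint l x w = y" _ length]
      word_exists[OF assms] by blast
  have "successively (\<noteq>) w"
  proof (rule ccontr)
    assume "\<not> ?thesis"
    then obtain r a s where v: "w = r @ [a, a] @ s"
      using not_successively_neqD by blast
    have "endpoint l x (r @ s) = y"
      using endpoint_cancel[OF l x, of r a s] w v by auto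
    then have "length w \<le> length (r @ s)"
      using w v by (intro least[rule_format]) auto
    then show False using v by simp
  qed
  with w show ?thesis by blast
qed

text \<open>
  If \<open>y \<noteq> x\<close>, then the geodesic from \<open>y\<close> to \<open>x\<close> extends beyond \<open>x\<close> by \<open>k\<close> further edges and
  ends at a vertex of the ball around \<open>x\<close> that has distance greater than \<open>k\<close> from \<open>y\<close>.
  Two labels suffice to continue a word without repeating its last letter.
\<close>

lemma ball_centre_unique:
  assumes l: "is_labelling T \<Omega> l" and x: "x \<in> V T" and y: "y \<in> V T"
    and \<Omega>: "2 \<le> card \<Omega>"
    and eq: "V (cball_of T x k) = V (cball_of T y k)"
  shows "x = y"
proof (rule ccontr)
  assume "x \<noteq> y"
  obtain u where u: "u \<in> lists \<Omega>" "successively (\<noteq>) u" "endpoint l y u = x"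
    using reduced_word_exists[OF l y x] by blast
  then have "u \<noteq> []" using \<open>x \<noteq> y\<close> by auto
  \<comment> \<open>The word \<open>u\<close> leads along the geodesic to \<open>x\<close>, and \<open>v\<close> continues it.\<close>
  have "\<exists>v. v \<in> lists \<Omega> \<and> successively (\<noteq>) (u @ v) \<and> length v = k" for k
  proof (induction k)
    case 0
    show ?case using u by (intro exI[of _ "[]"]) simp
  next
    case (Suc k)
    then obtain v where v: "v \<in> lists \<Omega>" "successively (\<noteq>) (u @ v)" "length v = k" by blast
    obtain a where "a \<in> \<Omega>" "a \<noteq> last (u @ v)"
    proof -
      have "\<not> \<Omega> \<subseteq> {last (u @ v)}"
        using \<Omega> card_mono[of "{last (u @ v)}" \<Omega>] by auto
      then show thesis using that by blast
    qed
    then have "successively (\<noteq>) ((u @ v) @ [a])"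
      using v(2) by (subst successively_append_iff) auto
    then show ?case
      using v \<open>a \<in> \<Omega>\<close> by (intro exI[of _ "v @ [a]"]) auto
  qed
  then obtain v where v: "v \<in> lists \<Omega>" "successively (\<noteq>) (u @ v)" "length v = k" by blast
  have "endpoint l x v \<in> V (cball_of T x k)"
    using v by (auto simp: verts_ball_endpoint[OF l x])
  then have "endpoint l x v \<in> V (cball_of T y k)"
    using eq by simp
  then obtain w where w: "w \<in> lists \<Omega>" "length w \<le> k" "endpoint l x v = endpoint l y w"
    by (auto simp: verts_ball_endpoint[OF l y])
  have "endpoint l y (u @ v) = endpoint l y w"
    using u w by simp
  then have "length (u @ v) \<le> length w"
    using reduced_word_shortest[OF l y _ v(2) w(1)] u(1) v(1) by simp
  then show False using v w \<open>u \<noteq> []\<close> by (cases u) auto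
qed

text \<open>
  The automorphism \<open>a\<close> of the ball extends to a label-preserving automorphism \<open>g\<close> of \<open>T\<close>, namely the one that
  moves \<open>x\<close> to \<open>fst a x\<close>.  It maps the ball around \<open>x\<close> to the ball around
  \<open>fst a x\<close>, but also onto itself; as a ball has only one centre, \<open>a\<close> fixes \<open>x\<close>.
\<close>

lemma label_iso_ball_id:
  assumes l: "is_labelling T \<Omega> l" and x: "x \<in> V T" and \<Omega>: "2 \<le> card \<Omega>"
    and a: "a \<in> label_isos (cball_of T x k) l (cball_of T x k) l"
  shows "a = gid (cball_of T x k)"
proof -
  let ?B = "cball_of T x k"
  have a_iso: "a \<in> graph_isos ?B ?B" using a by (rule label_isosD)
  have y: "fst a x \<in> V T"
    using graph_isos_verts[OF a_iso centre_in_ball[OF x]] verts_ball_subset by blast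
  then obtain g where g: "g \<in> label_isos T l T l" "fst g x = fst a x"
    using label_iso_exists[OF l l x] by blast
  have ga: "fst g v = fst a v" if "v \<in> V ?B" for v
    using label_hom_unique(1)[OF l l x label_hom_tree[OF g(1) arcs_ball_subset]
        label_hom_ball[OF a] g(2) that] .
  have "V ?B = fst a ` V ?B"
    using graph_isos_bij(1)[OF a_iso] by (simp add: bij_betw_def)
  also have "\<dots> = fst (grestrict ?B g) ` V ?B"
    using ga by (auto intro!: image_cong)
  also have "\<dots> = V (cball_of T (fst a x) k)"
    using graph_isos_bij(1)[OF grestrict_ball[OF label_isosD(1)[OF g(1)] x, of k]] g(2)
    by (simp add: bij_betw_def)
  finally have centre: "x = fst a x"
    by (rule ball_centre_unique[OF l x y \<Omega>])
  note unique = label_hom_unique[OF l l x label_hom_ball[OF a]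
      label_hom_tree[OF gid_label_isos[OF wf_tree] arcs_ball_subset]]
  show ?thesis
  proof (rule gmap_eqI[OF a_iso gid_isos[OF wf_ball]])
    show "fst a v = fst (gid ?B) v" if "v \<in> V ?B" for v
      using unique(1)[OF _ that] centre x that verts_ball_subset[of x k] by (auto simp: subset_iff)
    show "snd a e = snd (gid ?B) e" if "e \<in> E ?B" for e
      using unique(2)[OF _ that] centre x that arcs_ball_subset[of x k] by (auto simp: subset_iff)
  qed
qed

lemma chart_unique:
  assumes l: "is_labelling T \<Omega> l" and x: "x \<in> V T" and \<Omega>: "2 \<le> card \<Omega>"
    and f: "f \<in> label_isos (cball_of T x k) l B m" and f': "f' \<in> label_isos (cball_of T x k) l B m"
  shows "f = f'"
proof -
  let ?A = "cball_of T x k"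
  let ?a = "gcomp ?A (ginverse ?A B f') f"
  note F = label_isosD(1)[OF f] and F' = label_isosD(1)[OF f']
  have "?a \<in> label_isos ?A l ?A l"
    by (intro gcomp_label_isos[OF wf_ball f] ginverse_label_isos[OF wf_ball f'])
  then have a: "?a = gid ?A"
    by (rule label_iso_ball_id[OF l x \<Omega>])
  have "f = gcomp ?A (gcomp B f' (ginverse ?A B f')) f"
    using gcomp_ginverse_right[OF wf_ball F'] gcomp_gid_left[OF F] by simp
  also have "\<dots> = gcomp ?A f' (gid ?A)"
    using gcomp_assoc[OF F, of f' "ginverse ?A B f'"] a by simp
  also have "\<dots> = f'"
    by (rule gcomp_gid_right[OF F'])
  finally show ?thesis .
qed

end

section \<open>A labelling from involutive inversions\<close>

lemma carrier_Aut [simp]: "carrier (Aut G) = graph_isos G G"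
  and mult_Aut [simp]: "g \<otimes>\<^bsub>Aut G\<^esub> f = gcomp G g f"
  and one_Aut [simp]: "\<one>\<^bsub>Aut G\<^esub> = gid G"
  by (simp_all add: Aut_def)

context serre_tree
begin

text \<open>
  Being inverted by an involution in \<open>H\<close> is invariant under \<open>H\<close>: conjugate the involution.
\<close>

lemma conjugate_inversion:
  assumes H: "subgroup H (Aut T)" and g: "g \<in> H" "involutive_inversion T g"
    and e: "snd g e = bar T e" "e \<in> E T" and h: "h \<in> H"
  shows "\<exists>t \<in> H. snd t (snd h e) = bar T (snd h e) \<and> gcomp T t t = gid T"
proof -
  interpret A: group "Aut T" by (rule group_Aut[OF wf_tree])
  have gT: "g \<in> carrier (Aut T)" and hT: "h \<in> carrier (Aut T)"
    using subgroup.subset[OF H] g(1) h by blast+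
  let ?hi = "inv\<^bsub>Aut T\<^esub> h"
  have hi: "?hi \<in> carrier (Aut T)" "?hi \<in> H"
    by (rule A.inv_closed[OF hT], rule subgroup.m_inv_closed[OF H h])
  define t where "t = h \<otimes>\<^bsub>Aut T\<^esub> (g \<otimes>\<^bsub>Aut T\<^esub> ?hi)"
  have "g [^]\<^bsub>Aut T\<^esub> (2::nat) = \<one>\<^bsub>Aut T\<^esub>"
    using A.pow_ord_eq_1[OF gT] g(2) by (simp add: involutive_inversion_def)
  then have gg: "g \<otimes>\<^bsub>Aut T\<^esub> g = \<one>\<^bsub>Aut T\<^esub>"
    using A.nat_pow_Suc[of g 1] A.nat_pow_eone[OF gT] by (simp only: numeral_2_eq_2 One_nat_def)
  have tt: "t \<otimes>\<^bsub>Aut T\<^esub> t = \<one>\<^bsub>Aut T\<^esub>"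
  proof -
    have "t \<otimes>\<^bsub>Aut T\<^esub> t =
        h \<otimes>\<^bsub>Aut T\<^esub> (g \<otimes>\<^bsub>Aut T\<^esub> ((?hi \<otimes>\<^bsub>Aut T\<^esub> h) \<otimes>\<^bsub>Aut T\<^esub> (g \<otimes>\<^bsub>Aut T\<^esub> ?hi)))"
      unfolding t_def using gT hT hi(1) by (simp only: A.m_assoc A.m_closed)
    also have "\<dots> = h \<otimes>\<^bsub>Aut T\<^esub> ((g \<otimes>\<^bsub>Aut T\<^esub> g) \<otimes>\<^bsub>Aut T\<^esub> ?hi)"
      using gT hT hi(1) by (simp only: A.m_assoc A.m_closed A.l_inv A.l_one)
    also have "\<dots> = \<one>\<^bsub>Aut T\<^esub>"
      using gT hT hi(1) by (simp only: gg A.r_inv A.l_one)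
    finally show ?thesis .
  qed
  have "gcomp T ?hi h = gid T"
    using A.l_inv[OF hT] by simp
  then have "snd (gcomp T ?hi h) e = e"
    using e(2) by simp
  then have "snd ?hi (snd h e) = e"
    using e(2) by simp
  then have "snd t (snd h e) = snd h (bar T e)"
    using e hT graph_isos_arcs[of h T T e] by (simp add: t_def)
  also have "\<dots> = bar T (snd h e)"
    using graph_isos_morphism(3)[of h T T e] hT e(2) by simp
  finally show ?thesis
    using tt g(1) h hi(2) subgroup.m_closed[OF H]
    by (intro bexI[of _ t]) (simp_all add: t_def)
qed

end

text \<open>
  One involution in \<open>H\<close> is chosen for every edge with origin \<open>x0\<close>.  The group that they generate
  is handled through words, that is lists of edges at \<open>x0\<close>.
\<close>

locale inversion_family = serre_tree T for T :: "('v, 'e) serre_graph" +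
  fixes H :: "('v, 'e, 'v, 'e) gmap set" and x0 :: 'v
    and t :: "'e \<Rightarrow> ('v, 'e, 'v, 'e) gmap"
  assumes H: "subgroup H (Aut T)" and x0: "x0 \<in> V T"
    and t_in: "a \<in> out_arcs (und T) x0 \<Longrightarrow> t a \<in> H"
    and t_inverts: "a \<in> out_arcs (und T) x0 \<Longrightarrow> snd (t a) a = bar T a"
    and t_involution: "a \<in> out_arcs (und T) x0 \<Longrightarrow> gcomp T (t a) (t a) = gid T"
begin

abbreviation A :: "'e set" where
  "A \<equiv> out_arcs (und T) x0"

lemma H_isos: "h \<in> H \<Longrightarrow> h \<in> graph_isos T T"
  using subgroup.subset[OF H] by auto

lemma H_gcomp: "g \<in> H \<Longrightarrow> h \<in> H \<Longrightarrow> gcomp T g h \<in> H"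
  using subgroup.m_closed[OF H, of g h] by simp

primrec word_act :: "'e list \<Rightarrow> ('v, 'e, 'v, 'e) gmap" where
  "word_act [] = gid T"
| "word_act (a # w) = gcomp T (t a) (word_act w)"

text \<open>
  The walk from \<open>x0\<close> to its image under \<open>word_act w\<close> whose \<open>i\<close>-th edge is the \<open>i\<close>-th letter of \<open>w\<close>,
  translated by the product of the letters before it.
\<close>

primrec word_path :: "'e list \<Rightarrow> 'e list" where
  "word_path [] = []"
| "word_path (a # w) = a # map (snd (t a)) (word_path w)"

lemma word_act_H: "w \<in> lists A \<Longrightarrow> word_act w \<in> H"
proof (induction w)
  case Nil
  show ?case using subgroup.one_closed[OF H] by simp
next
  case (Cons a w)
  then show ?case
    using H_gcomp[OF t_in[of a] Cons.IH] by (simp del: in_out_arcs_conv)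
qed

lemma word_act_isos: "w \<in> lists A \<Longrightarrow> word_act w \<in> graph_isos T T"
  by (intro H_isos word_act_H)

lemma t_isos: "a \<in> A \<Longrightarrow> t a \<in> graph_isos T T"
  by (intro H_isos t_in)

lemma t_base: "a \<in> A \<Longrightarrow> fst (t a) x0 = head (und T) a"
  using graph_isos_morphism(1)[OF t_isos, of a a] t_inverts[of a] by simp

lemma word_act_append:
  assumes "u \<in> lists A" "w \<in> lists A"
  shows "word_act (u @ w) = gcomp T (word_act u) (word_act w)"
  using assms(1)
proof (induction u)
  case Nil
  show ?case using gcomp_gid_left[OF word_act_isos[OF assms(2)]] by simp
next
  case (Cons a u)
  then show ?case using gcomp_assoc[OF word_act_isos[OF assms(2)], of "t a" "word_act u"] by simp
qed

lemma word_act_square: "a \<in> A \<Longrightarrow> word_act [a, a] = gid T"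
  using gcomp_gid_right[OF t_isos] t_involution by simp

lemma word_act_cancel:
  assumes "u \<in> lists A" "a \<in> A" "v \<in> lists A"
  shows "word_act (u @ [a, a] @ v) = word_act (u @ v)"
proof -
  have "word_act ([a, a] @ v) = word_act v"
    using word_act_append[of "[a, a]" v] word_act_square[OF assms(2)] gcomp_gid_left[OF word_act_isos] assms
    by simp
  then show ?thesis
    using word_act_append[of u "[a, a] @ v"] word_act_append[of u v] assms by simp
qed

lemma word_act_rev:
  assumes "w \<in> lists A"
  shows "gcomp T (word_act (rev w)) (word_act w) = gid T"
proof -
  have "word_act (rev w @ w) = gid T"
    using assms
  proof (induction w)
    case (Cons a w)
    then show ?case using word_act_cancel[of "rev w" a w] by simp
  qed (simp only: rev.simps append.simps word_act.simps)
  then show ?thesis using word_act_append[of "rev w" w] assms by simp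
qed

lemma awalk_word_path:
  assumes "w \<in> lists A"
  shows "awalk x0 (word_path w) (fst (word_act w) x0)"
  using assms
proof (induction w)
  case Nil
  show ?case using x0 by (simp add: awalk_Nil_iff)
next
  case (Cons a w)
  then have a: "a \<in> A" "a \<in> E T" "tail (und T) a = x0" by auto
  have "awalk (head (und T) a) (map (snd (t a)) (word_path w)) (fst (word_act (a # w)) x0)"
    using awalk_image[OF t_isos[OF a(1)] Cons.IH] t_base[OF a(1)] x0 by simp
  then show ?case using a by (simp add: awalk_Cons_iff)
qed

lemma nonbacktracking_image:
  assumes "g \<in> graph_isos T T" "nonbacktracking p" "set p \<subseteq> E T"
  shows "nonbacktracking (map (snd g) p)"
  using assms(2,3)
proof (induction p rule: induct_list012)
  case (3 e f p)
  then have "snd g f \<noteq> bar T (snd g e)"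
    using graph_isos_morphism(3)[OF assms(1), of e] graph_isos_inj(2)[OF assms(1), of f "bar T e"]
    by simp
  with 3 show ?case by simp
qed simp_all

text \<open>
  After the edge \<open>a\<close> the walk of \<open>a # b # w\<close> uses \<open>t a\<close> applied to \<open>b\<close>.  As \<open>t a\<close> maps \<open>a\<close> to the inverse of \<open>a\<close>,
  this is a backtracking only for \<open>b = a\<close>.
\<close>

lemma nonbacktracking_word_path:
  assumes "w \<in> lists A" "successively (\<noteq>) w"
  shows "nonbacktracking (word_path w)"
  using assms
proof (induction w rule: induct_list012)
  case (3 a b w)
  then have ab: "a \<in> A" "b \<in> A" "a \<noteq> b" and w: "b # w \<in> lists A" "successively (\<noteq>) (b # w)"
    by simp_all
  have "set (word_path (b # w)) \<subseteq> E T"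
    using awalk_word_path[OF w(1)] unfolding awalk_def by blast
  then have "nonbacktracking (map (snd (t a)) (word_path (b # w)))"
    using nonbacktracking_image[OF t_isos[OF ab(1)] 3(2)[OF w]] by blast
  moreover have "snd (t a) b \<noteq> bar T a"
    using graph_isos_inj(2)[OF t_isos[OF ab(1)], of a b] t_inverts[OF ab(1)] ab by auto
  ultimately show ?case by simp
qed simp_all

text \<open>
  Repeated letters cancel because the generators are involutions; a word without repeated
  letters that fixes \<open>x0\<close> traces a closed walk without backtracking and is therefore empty.
\<close>

lemma word_act_free:
  assumes "w \<in> lists A" "fst (word_act w) x0 = x0"
  shows "word_act w = gid T"
  using assms
proof (induction w rule: length_induct)
  case (1 w)
  show ?case
  proof (cases "successively (\<noteq>) w")
    case True
    have "awalk x0 (word_path w) x0"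
      using awalk_word_path[OF 1(2)] 1(3) by simp
    then have "word_path w = []"
      using nonbacktracking_word_path[OF 1(2) True] by (rule closed_nonbacktracking_walk_empty)
    then have "w = []" by (cases w) auto
    then show ?thesis by (simp only: word_act.simps)
  next
    case False
    then obtain u a v where w: "w = u @ [a, a] @ v"
      using not_successively_neqD by blast
    with 1(2) have uav: "u \<in> lists A" "a \<in> A" "v \<in> lists A" by auto
    have eq: "word_act w = word_act (u @ v)"
      using word_act_cancel[OF uav] w by simp
    show ?thesis
      unfolding eq
    proof (rule 1(1)[rule_format])
      show "length (u @ v) < length w" "u @ v \<in> lists A" using w uav by simp_all
      show "fst (word_act (u @ v)) x0 = x0" using 1(3) eq by simp
    qed
  qed
qed

lemma word_act_inj:
  assumes "u \<in> lists A" "w \<in> lists A" "fst (word_act u) x0 = fst (word_act w) x0"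
  shows "word_act u = word_act w"
proof -
  have ru: "rev u \<in> lists A" using assms(1) by simp
  have "fst (word_act (rev u @ w)) x0 = fst (gcomp T (word_act (rev u)) (word_act u)) x0"
    using word_act_append[OF ru assms(2)] assms(3) x0 by simp
  then have "fst (word_act (rev u @ w)) x0 = x0"
    using word_act_rev[OF assms(1)] x0 by simp
  then have "gcomp T (word_act (rev u)) (word_act w) = gid T"
    using word_act_free[of "rev u @ w"] word_act_append[OF ru assms(2)] ru assms(2) by simp
  moreover have "word_act w = gcomp T (gcomp T (word_act u) (word_act (rev u))) (word_act w)"
    using word_act_rev[OF ru] gcomp_gid_left[OF word_act_isos[OF assms(2)]] by simp
  ultimately show ?thesis
    using gcomp_assoc[OF word_act_isos[OF assms(2)], of "word_act u" "word_act (rev u)"]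
      gcomp_gid_right[OF word_act_isos[OF assms(1)]] by simp
qed

lemma arc_translate:
  assumes "e \<in> E T" "w \<in> lists A" "fst (word_act w) x0 = tail (und T) e"
  shows "\<exists>a \<in> A. e = snd (word_act w) a"
proof -
  note iso = word_act_isos[OF assms(2)]
  obtain a where a: "a \<in> E T" "e = snd (word_act w) a"
    using graph_isos_surj(2)[OF iso assms(1)] by blast
  have "tail (und T) a = x0"
    using graph_isos_morphism(1)[OF iso a(1)] graph_isos_inj(1)[OF iso, of "tail (und T) a" x0]
      a assms(3) x0 by simp
  then show ?thesis using a by auto
qed

lemma word_act_transitive:
  assumes "y \<in> V T"
  shows "\<exists>w \<in> lists A. fst (word_act w) x0 = y"
proof -
  have "x0 \<rightarrow>\<^sup>*\<^bsub>und T\<^esub> y"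
    using tree assms x0 unfolding is_tree_def strongly_connected_def by blast
  then obtain p where "awalk x0 p y" unfolding reachable_awalk by blast
  then show ?thesis
  proof (induction p arbitrary: y rule: rev_induct)
    case Nil
    then show ?case using x0 by (intro bexI[of _ "[]"]) (simp_all add: awalk_Nil_iff)
  next
    case (snoc e p)
    then have e: "e \<in> E T" "head (und T) e = y"
      by (simp_all add: awalk_Cons_iff awalk_Nil_iff)
    have p: "awalk x0 p (tail (und T) e)"
      using snoc.prems by (simp add: awalk_Cons_iff) metis
    from snoc.IH[OF p] obtain w where w: "w \<in> lists A" "fst (word_act w) x0 = tail (und T) e" by blast
    note iso = word_act_isos[OF w(1)]
    obtain a where aA: "a \<in> A" and a: "a \<in> E T" "e = snd (word_act w) a"
      using arc_translate[OF e(1) w] by auto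
    have "y = fst (word_act w) (fst (t a) x0)"
      using graph_isos_morphism(2)[OF iso a(1)] a(2) e(2) t_base[OF aA] by simp
    also have "\<dots> = fst (word_act (w @ [a])) x0"
      using word_act_append[OF w(1), of "[a]"] aA x0 graph_isos_verts[OF t_isos[OF aA] x0] by simp
    finally show ?case
      using w(1) aA by (intro bexI[of _ "w @ [a]"]) simp_all
  qed
qed

text \<open>
  Every edge is a translate of exactly one edge at \<open>x0\<close>, from which it inherits its label.
\<close>

definition orbit_label :: "('e \<Rightarrow> 'o) \<Rightarrow> 'e \<Rightarrow> 'o" where
  "orbit_label b e = b (SOME a. a \<in> A \<and> (\<exists>w \<in> lists A. snd (word_act w) a = e))"

lemma orbit_label_eq:
  assumes "w \<in> lists A" "a \<in> A"
  shows "orbit_label b (snd (word_act w) a) = b a"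
proof -
  have "a' = a" if a': "a' \<in> A" "u \<in> lists A" "snd (word_act u) a' = snd (word_act w) a" for a' u
  proof -
    have "fst (word_act u) x0 = tail (und T) (snd (word_act u) a')"
      using graph_isos_morphism(1)[OF word_act_isos[OF a'(2)], of a'] a'(1) by simp
    also have "\<dots> = fst (word_act w) x0"
      using graph_isos_morphism(1)[OF word_act_isos[OF assms(1)], of a] assms(2) a'(3) by simp
    finally have "word_act u = word_act w" by (rule word_act_inj[OF a'(2) assms(1)])
    then show ?thesis
      using graph_isos_inj(2)[OF word_act_isos[OF assms(1)], of a' a] a' assms(2) by simp
  qed
  then have "(SOME a'. a' \<in> A \<and> (\<exists>u \<in> lists A. snd (word_act u) a' = snd (word_act w) a)) = a"
    using assms by (intro some_equality) auto
  then show ?thesis by (simp add: orbit_label_def)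
qed

text \<open>
  The vertex \<open>y\<close> is a translate of \<open>x0\<close>, so its edges carry the same labels as those at \<open>x0\<close>.
  An edge and its inverse lie in one orbit because \<open>t a\<close> inverts \<open>a\<close>.
\<close>

lemma orbit_label_labelling:
  assumes b: "bij_betw b A \<Omega>"
  shows "is_labelling T \<Omega> (orbit_label b)"
  unfolding is_labelling_def
proof (intro conjI ballI)
  fix y assume y: "y \<in> V T"
  obtain w where w: "w \<in> lists A" "fst (word_act w) x0 = y"
    using word_act_transitive[OF y] by blast
  note iso = word_act_isos[OF w(1)]
  have out: "out_arcs (und T) y = snd (word_act w) ` A"
  proof (intro subset_antisym subsetI)
    fix e assume "e \<in> out_arcs (und T) y"
    then show "e \<in> snd (word_act w) ` A"
      using arc_translate[OF _ w(1), of e] w(2) by auto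
  next
    fix e assume "e \<in> snd (word_act w) ` A"
    then show "e \<in> out_arcs (und T) y"
      using graph_isos_arcs[OF iso] graph_isos_morphism(1)[OF iso] w(2) by auto
  qed
  have "inj_on (snd (word_act w)) A"
    using graph_isos_inj(2)[OF iso] by (auto intro: inj_onI)
  moreover have "bij_betw (orbit_label b \<circ> snd (word_act w)) A \<Omega>"
    using b by (rule bij_betw_cong[THEN iffD1, rotated]) (simp only: o_apply orbit_label_eq[OF w(1)])
  ultimately show "bij_betw (orbit_label b) (out_arcs (und T) y) \<Omega>"
    unfolding out by (auto simp: bij_betw_def inj_on_def image_comp)
next
  fix e assume e: "e \<in> E T"
  obtain w where w: "w \<in> lists A" "fst (word_act w) x0 = tail (und T) e"
    using word_act_transitive[of "tail (und T) e"] e by auto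
  obtain a where a: "a \<in> A" "e = snd (word_act w) a"
    using arc_translate[OF e w] by blast
  have aE: "a \<in> E T" using a(1) by simp
  have "bar T e = snd (word_act w) (snd (t a) a)"
    using graph_isos_morphism(3)[OF word_act_isos[OF w(1)] aE] a t_inverts by simp
  also have "\<dots> = snd (word_act (w @ [a])) a"
    using word_act_append[OF w(1), of "[a]"] a(1) aE graph_isos_arcs[OF t_isos[OF a(1)] aE] by simp
  finally have "orbit_label b (bar T e) = b a"
    using orbit_label_eq[of "w @ [a]" a b] w(1) a(1) by simp
  then show "orbit_label b (bar T e) = orbit_label b e"
    using orbit_label_eq[OF w(1) a(1), of b] unfolding a(2) by simp
qed

lemma word_act_label_iso:
  assumes w: "w \<in> lists A"
  shows "word_act w \<in> label_isos T (orbit_label b) T (orbit_label b)"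
  unfolding label_isos_def
proof (intro CollectI conjI ballI word_act_isos[OF w])
  fix e assume e: "e \<in> E T"
  obtain u where u: "u \<in> lists A" "fst (word_act u) x0 = tail (und T) e"
    using word_act_transitive[of "tail (und T) e"] e by auto
  obtain a where a: "a \<in> A" "e = snd (word_act u) a"
    using arc_translate[OF e u] by blast
  have "snd (word_act w) e = snd (word_act (w @ u)) a"
    using word_act_append[OF w u(1)] a by simp
  then show "orbit_label b (snd (word_act w) e) = orbit_label b e"
    using orbit_label_eq[of "w @ u" a b] orbit_label_eq[OF u(1) a(1), of b] w u(1) a by simp
qed

text \<open>
  Some word moves \<open>x0\<close> to the same vertex as the given automorphism, and two label-preserving
  automorphisms that agree at a vertex are equal.
\<close>

lemma label_autos_subset:
  assumes b: "bij_betw b A \<Omega>"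
  shows "label_isos T (orbit_label b) T (orbit_label b) \<subseteq> H"
proof
  fix g assume g: "g \<in> label_isos T (orbit_label b) T (orbit_label b)"
  obtain w where w: "w \<in> lists A" "fst (word_act w) x0 = fst g x0"
    using word_act_transitive graph_isos_verts[OF label_isosD(1)[OF g] x0] by blast
  note l = orbit_label_labelling[OF b]
  have "g = word_act w"
    by (rule label_iso_unique[OF l l x0 g word_act_label_iso[OF w(1)] w(2)[symmetric]])
  then show "g \<in> H" using word_act_H[OF w(1)] by simp
qed

end

section \<open>Local actions\<close>

text \<open>
  At least two labels are needed: with a single one, the ball of radius \<open>1\<close> would be an edge, which has
  a label-preserving automorphism exchanging its ends, and charts would not be unique.
\<close>

locale ball_charts = serre_tree T for T :: "('v, 'e) serre_graph" +
  fixes \<Omega> :: "'o set" and l :: "'e \<Rightarrow> 'o" and k :: nat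
    and B :: "('w, 'f) serre_graph" and lB :: "'f \<Rightarrow> 'o"
  assumes l: "is_labelling T \<Omega> l" and \<Omega>: "2 \<le> card \<Omega>" and k: "1 \<le> k"
    and model: "labelled_ball_model T \<Omega> k B lB"
begin

abbreviation ball :: "'v \<Rightarrow> ('v, 'e) serre_graph" where
  "ball x \<equiv> cball_of T x k"

abbreviation chart :: "'v \<Rightarrow> ('v, 'e, 'w, 'f) gmap" where
  "chart x \<equiv> ball_chart T B lB l k x"

abbreviation \<sigma> :: "('v, 'e, 'v, 'e) gmap \<Rightarrow> 'v \<Rightarrow> ('w, 'f, 'w, 'f) gmap" where
  "\<sigma> g x \<equiv> local_action T B lB l k g x"

lemma chart:
  assumes x: "x \<in> V T"
  shows "chart x \<in> label_isos (ball x) l B lB"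
proof -
  obtain l' x' f where l': "is_labelling T \<Omega> l'" and x': "x' \<in> V T"
    and f: "f \<in> label_isos (ball x') l' B lB"
    using model unfolding labelled_ball_model_def by blast
  obtain g where g: "g \<in> label_isos T l T l'" "fst g x = x'"
    using label_iso_exists[OF l l' x x'] by blast
  have "grestrict (ball x) g \<in> label_isos (ball x) l (ball x') l'"
    using grestrict_ball_label[OF g(1) x] g(2) by simp
  then have c: "gcomp (ball x) f (grestrict (ball x) g) \<in> label_isos (ball x) l B lB"
    using f by (rule gcomp_label_isos[OF wf_ball])
  show ?thesis
    unfolding ball_chart_def by (rule theI, rule c, rule chart_unique[OF l x \<Omega> _ c])
qed

lemma chart_iso: "x \<in> V T \<Longrightarrow> chart x \<in> graph_isos (ball x) B"
  using chart by (rule label_isosD)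

lemma wf_model: "wf_serre_graph B"
proof -
  obtain l' x' f where "f \<in> label_isos (ball x') l' B lB"
    using model unfolding labelled_ball_model_def by blast
  then show ?thesis by (intro wf_serre_graph_transfer[OF wf_ball label_isosD(1)])
qed

lemma local_action_iso:
  assumes g: "g \<in> graph_isos T T" and x: "x \<in> V T"
  shows "\<sigma> g x \<in> graph_isos B B"
proof -
  have "gcomp (ball x) (chart (fst g x)) g = gcomp (ball x) (chart (fst g x)) (grestrict (ball x) g)"
    by (auto simp: gcomp_def compose_def grestrict_def)
  also have "\<dots> \<in> graph_isos (ball x) B"
    by (rule gcomp_isos[OF wf_ball grestrict_ball[OF g x] chart_iso[OF graph_isos_verts[OF g x]]])
  finally show ?thesis
    unfolding local_action_def
    by (rule gcomp_isos[OF wf_model ginverse_isos[OF wf_ball chart_iso[OF x]]])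
qed

lemma local_action_apply:
  assumes x: "x \<in> V T"
  shows "v \<in> V (ball x) \<Longrightarrow> fst (\<sigma> g x) (fst (chart x) v) = fst (chart (fst g x)) (fst g v)"
    and "e \<in> E (ball x) \<Longrightarrow> snd (\<sigma> g x) (snd (chart x) e) = snd (chart (fst g x)) (snd g e)"
  using chart_iso[OF x]
  by (simp_all add: local_action_def graph_isos_verts graph_isos_arcs ginverse_apply)

text \<open>
  Together with \<open>local_action_apply\<close>, this characterizes the local action as the only
  automorphism \<open>s\<close> of the model with \<open>s \<circ> chart x = chart (g x) \<circ> g\<close> on the ball.
\<close>

lemma local_action_eqI:
  assumes g: "g \<in> graph_isos T T" and x: "x \<in> V T" and s: "s \<in> graph_isos B B"
    and verts: "\<And>v. v \<in> V (ball x) \<Longrightarrow> fst s (fst (chart x) v) = fst (chart (fst g x)) (fst g v)"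
    and arcs: "\<And>e. e \<in> E (ball x) \<Longrightarrow> snd s (snd (chart x) e) = snd (chart (fst g x)) (snd g e)"
  shows "\<sigma> g x = s"
proof (rule gmap_eqI[OF local_action_iso[OF g x] s])
  fix v assume "v \<in> V B"
  then obtain u where "u \<in> V (ball x)" "v = fst (chart x) u"
    using graph_isos_surj(1)[OF chart_iso[OF x]] by blast
  then show "fst (\<sigma> g x) v = fst s v"
    using verts local_action_apply(1)[OF x] by simp
next
  fix e assume "e \<in> E B"
  then obtain u where "u \<in> E (ball x)" "e = snd (chart x) u"
    using graph_isos_surj(2)[OF chart_iso[OF x]] by blast
  then show "snd (\<sigma> g x) e = snd s e"
    using arcs local_action_apply(2)[OF x] by simp
qed

lemma local_action_cocycle:
  assumes g: "g \<in> graph_isos T T" and h: "h \<in> graph_isos T T" and x: "x \<in> V T"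
  shows "\<sigma> (gcomp T g h) x = gcomp B (\<sigma> g (fst h x)) (\<sigma> h x)"
proof (rule local_action_eqI[OF gcomp_isos[OF wf_tree h g] x])
  note hx = graph_isos_verts[OF h x]
  note chart_x = chart_iso[OF x]
  show "gcomp B (\<sigma> g (fst h x)) (\<sigma> h x) \<in> graph_isos B B"
    by (rule gcomp_isos[OF wf_model local_action_iso[OF h x] local_action_iso[OF g hx]])
  show "fst (gcomp B (\<sigma> g (fst h x)) (\<sigma> h x)) (fst (chart x) v) =
      fst (chart (fst (gcomp T g h) x)) (fst (gcomp T g h) v)" if v: "v \<in> V (ball x)" for v
    using v x verts_ball_subset[of x k] graph_isos_verts[OF chart_x v] ball_image[OF h v]
    by (simp add: local_action_apply[OF x] local_action_apply[OF hx] subset_iff)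
  show "snd (gcomp B (\<sigma> g (fst h x)) (\<sigma> h x)) (snd (chart x) e) =
      snd (chart (fst (gcomp T g h) x)) (snd (gcomp T g h) e)" if e: "e \<in> E (ball x)" for e
    using e x arcs_ball_subset[of x k] graph_isos_arcs[OF chart_x e]
      graph_isos_arcs[OF grestrict_ball[OF h x] e]
    by (simp add: local_action_apply[OF x] local_action_apply[OF hx] subset_iff)
qed

text \<open>
  Composing \<open>g\<close> with the chart at \<open>fst g x\<close> gives a label-preserving isomorphism from the ball
  around \<open>x\<close> to the model.  By uniqueness it is the chart at \<open>x\<close>.
\<close>

lemma local_action_label:
  assumes g: "g \<in> label_isos T l T l" and x: "x \<in> V T"
  shows "\<sigma> g x = gid B"
proof -
  note gx = graph_isos_verts[OF label_isosD(1)[OF g] x]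
  have eq: "chart x = gcomp (ball x) (chart (fst g x)) (grestrict (ball x) g)"
    by (rule chart_unique[OF l x \<Omega> chart[OF x]
          gcomp_label_isos[OF wf_ball grestrict_ball_label[OF g x] chart[OF gx]]])
  show ?thesis
  proof (rule local_action_eqI[OF label_isosD(1)[OF g] x gid_isos[OF wf_model]])
    fix v assume v: "v \<in> V (ball x)"
    have "fst (chart x) v = fst (chart (fst g x)) (fst g v)"
      using v by (subst eq) simp
    then show "fst (gid B) (fst (chart x) v) = fst (chart (fst g x)) (fst g v)"
      using graph_isos_verts[OF chart_iso[OF x] v] by simp
  next
    fix e assume e: "e \<in> E (ball x)"
    have "snd (chart x) e = snd (chart (fst g x)) (snd g e)"
      using e by (subst eq) simp
    then show "snd (gid B) (snd (chart x) e) = snd (chart (fst g x)) (snd g e)"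
      using graph_isos_arcs[OF chart_iso[OF x] e] by simp
  qed
qed

text \<open>
  Each edge lies in the ball around its origin, where the charts transport its label to the
  model; this uses that the radius is positive.
\<close>

lemma label_iso_if_local_action_id:
  assumes g: "g \<in> graph_isos T T" and id: "\<And>x. x \<in> V T \<Longrightarrow> \<sigma> g x = gid B"
  shows "g \<in> label_isos T l T l"
  unfolding label_isos_def
proof (intro CollectI conjI ballI g)
  fix e assume e: "e \<in> E T"
  let ?x = "tail (und T) e"
  have x: "?x \<in> V T" and eB: "e \<in> E (ball ?x)"
    using e out_arcs_in_ball[OF e k] by simp_all
  note gx = graph_isos_verts[OF g x]
  have geB: "snd g e \<in> E (ball (fst g ?x))"
    using graph_isos_arcs[OF grestrict_ball[OF g x] eB] eB by simp
  have "snd (chart (fst g ?x)) (snd g e) = snd (chart ?x) e"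
    using local_action_apply(2)[OF x eB, of g] id[OF x] graph_isos_arcs[OF chart_iso[OF x] eB]
    by simp
  then show "l (snd g e) = l e"
    using label_isosD(2)[OF chart[OF gx] geB] label_isosD(2)[OF chart[OF x] eB] by simp
qed

text \<open>
  Label-preserving automorphisms can be used to move the vertex at which a local action is
  taken, and its image, to any place.
\<close>

lemma local_action_conjugate:
  assumes g: "g \<in> graph_isos T T" and a: "a \<in> label_isos T l T l" and b: "b \<in> label_isos T l T l"
    and x: "x \<in> V T"
  shows "\<sigma> (gcomp T b (gcomp T g a)) x = \<sigma> g (fst a x)"
proof -
  note A = label_isosD(1)[OF a] and C = label_isosD(1)[OF b]
  note ax = graph_isos_verts[OF A x]
  note s = local_action_iso[OF g ax]
  have "\<sigma> (gcomp T g a) x = \<sigma> g (fst a x)"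
    using local_action_cocycle[OF g A x] local_action_label[OF a x] gcomp_gid_right[OF s] by simp
  then show ?thesis
    using local_action_cocycle[OF C gcomp_isos[OF wf_tree A g] x] gcomp_gid_left[OF s]
      local_action_label[OF b graph_isos_verts[OF g ax]] x by simp
qed

lemma local_action_eq_iff:
  assumes g: "g \<in> graph_isos T T" and h: "h \<in> graph_isos T T" and x: "x \<in> V T"
    and same: "fst g x = fst h x"
  shows "\<sigma> g x = \<sigma> h x \<longleftrightarrow> grestrict (ball x) g = grestrict (ball x) h"
proof
  note gx = graph_isos_verts[OF g x]
  note rg = grestrict_ball[OF g x, of k] and rh = grestrict_ball[OF h x, of k, folded same]
  assume eq: "\<sigma> g x = \<sigma> h x"
  show "grestrict (ball x) g = grestrict (ball x) h"
  proof (rule gmap_eqI[OF rg rh])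
    fix v assume v: "v \<in> V (ball x)"
    have "fst (chart (fst g x)) (fst g v) = fst (chart (fst g x)) (fst h v)"
      using local_action_apply(1)[OF x v, of g] local_action_apply(1)[OF x v, of h] eq same by simp
    then show "fst (grestrict (ball x) g) v = fst (grestrict (ball x) h) v"
      using graph_isos_inj(1)[OF chart_iso[OF gx]] graph_isos_verts[OF rg v]
        graph_isos_verts[OF rh v] v by simp
  next
    fix e assume e: "e \<in> E (ball x)"
    have "snd (chart (fst g x)) (snd g e) = snd (chart (fst g x)) (snd h e)"
      using local_action_apply(2)[OF x e, of g] local_action_apply(2)[OF x e, of h] eq same by simp
    then show "snd (grestrict (ball x) g) e = snd (grestrict (ball x) h) e"
      using graph_isos_inj(2)[OF chart_iso[OF gx]] graph_isos_arcs[OF rg e]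
        graph_isos_arcs[OF rh e] e by simp
  qed
next
  assume eq: "grestrict (ball x) g = grestrict (ball x) h"
  have v: "fst g v = fst h v" if "v \<in> V (ball x)" for v
    using that eq grestrict_apply(1)[of v "ball x" g] grestrict_apply(1)[of v "ball x" h] by simp
  have e: "snd g e = snd h e" if "e \<in> E (ball x)" for e
    using that eq grestrict_apply(2)[of e "ball x" g] grestrict_apply(2)[of e "ball x" h] by simp
  show "\<sigma> g x = \<sigma> h x"
    by (rule local_action_eqI[OF g x local_action_iso[OF h x]])
      (simp_all add: local_action_apply[OF x] v e same)
qed

text \<open>
  This is the group \<open>F k\<close> of the theorem.  Ranging over all vertices instead of fixing one makes
  the definition independent of a choice; by \<open>local_actions_stab\<close> one vertex suffices.
\<close>

definition local_actions :: "('v, 'e, 'v, 'e) gmap set \<Rightarrow> ('w, 'f, 'w, 'f) gmap set" where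
  "local_actions H = {\<sigma> h x | h x. h \<in> H \<and> x \<in> V T}"

context
  fixes H :: "('v, 'e, 'v, 'e) gmap set"
  assumes H: "subgroup H (Aut T)" and label_H: "label_isos T l T l \<subseteq> H"
begin

lemma H_iso: "h \<in> H \<Longrightarrow> h \<in> graph_isos T T"
  using subgroup.subset[OF H] by auto

lemma H_comp: "g \<in> H \<Longrightarrow> h \<in> H \<Longrightarrow> gcomp T g h \<in> H"
  using subgroup.m_closed[OF H, of g h] by simp

text \<open>
  For \<open>h \<in> H\<close> and a vertex \<open>y\<close>, label-preserving automorphisms \<open>a\<close> and \<open>b\<close> with
  \<open>a x = y\<close> and \<open>b (h y) = x\<close> turn \<open>h\<close> into the element \<open>b h a\<close> of the stabilizer of \<open>x\<close> with the same local
  action.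
\<close>

lemma local_actions_stab:
  assumes x: "x \<in> V T"
  shows "local_actions H = (\<lambda>h. \<sigma> h x) ` stab H x"
proof (intro subset_antisym subsetI)
  fix s assume "s \<in> local_actions H"
  then obtain h y where h: "h \<in> H" "y \<in> V T" "s = \<sigma> h y"
    unfolding local_actions_def by blast
  obtain a where a: "a \<in> label_isos T l T l" "fst a x = y"
    using label_iso_exists[OF l l x h(2)] by blast
  obtain b where b: "b \<in> label_isos T l T l" "fst b (fst h y) = x"
    using label_iso_exists[OF l l graph_isos_verts[OF H_iso[OF h(1)] h(2)] x] by blast
  let ?g = "gcomp T b (gcomp T h a)"
  have "?g \<in> H"
    using H_comp[OF _ H_comp[OF h(1)]] label_H a(1) b(1) by blast
  then have "?g \<in> stab H x"
    using a(2) b(2) x by (simp add: stab_def)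
  moreover have "s = \<sigma> ?g x"
    using local_action_conjugate[OF H_iso[OF h(1)] a(1) b(1) x] a(2) h(3) by simp
  ultimately show "s \<in> (\<lambda>h. \<sigma> h x) ` stab H x" by blast
next
  fix s assume "s \<in> (\<lambda>h. \<sigma> h x) ` stab H x"
  then show "s \<in> local_actions H"
    using x unfolding local_actions_def stab_def by blast
qed

lemma subset_univ_group: "H \<subseteq> univ_group T B lB l k (local_actions H)"
proof
  fix h assume h: "h \<in> H"
  then have "\<sigma> h x \<in> local_actions H" if "x \<in> V T" for x
    using that unfolding local_actions_def by blast
  then show "h \<in> univ_group T B lB l k (local_actions H)"
    using H_iso[OF h] by (simp add: univ_group_def)
qed

lemma stab_cocycle:
  assumes "g \<in> stab H x" "h \<in> stab H x" "x \<in> V T"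
  shows "\<sigma> (gcomp T g h) x = gcomp B (\<sigma> g x) (\<sigma> h x)"
  using local_action_cocycle[of g h x] assms H_iso by (simp add: stab_def)

lemma stab_comp:
  assumes "g \<in> stab H x" "h \<in> stab H x" "x \<in> V T"
  shows "gcomp T g h \<in> stab H x"
  using assms H_comp by (simp add: stab_def)

lemma subgroup_local_actions: "subgroup (local_actions H) (Aut B)"
proof -
  obtain x where x: "x \<in> V T"
    using model unfolding labelled_ball_model_def by blast
  interpret A: group "Aut T" by (rule group_Aut[OF wf_tree])
  interpret AB: group "Aut B" by (rule group_Aut[OF wf_model])
  note F = local_actions_stab[OF x]
  have one: "gid T \<in> stab H x"
    using subgroup.one_closed[OF H] x by (simp add: stab_def)
  show ?thesis
  proof (rule AB.subgroupI)
    show "local_actions H \<subseteq> carrier (Aut B)"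
    proof
      fix s assume "s \<in> local_actions H"
      then obtain h y where "h \<in> H" "y \<in> V T" "s = \<sigma> h y"
        unfolding local_actions_def by blast
      then show "s \<in> carrier (Aut B)"
        using local_action_iso[OF H_iso, of h y] by simp
    qed
    show "local_actions H \<noteq> {}"
      using one unfolding F by blast
  next
    fix s assume "s \<in> local_actions H"
    then obtain h where h: "h \<in> stab H x" "s = \<sigma> h x" unfolding F by blast
    then have hH: "h \<in> H" "fst h x = x" by (simp_all add: stab_def)
    let ?hi = "inv\<^bsub>Aut T\<^esub> h"
    have hi: "?hi \<in> H"
      using subgroup.m_inv_closed[OF H hH(1)] .
    have inv: "gcomp T ?hi h = gid T"
      using A.l_inv[of h] H_iso[OF hH(1)] by simp
    then have "fst (gcomp T ?hi h) x = x" using x by simp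
    then have hi_stab: "?hi \<in> stab H x"
      using hi hH x by (simp add: stab_def)
    have "gcomp B (\<sigma> ?hi x) s = gid B"
      using stab_cocycle[OF hi_stab h(1) x] inv local_action_label[OF gid_label_isos[OF wf_tree] x] h(2)
      by simp
    then have "inv\<^bsub>Aut B\<^esub> s = \<sigma> ?hi x"
      using AB.inv_equality[of "\<sigma> ?hi x" s] h(2) local_action_iso[OF H_iso x]
        hH(1) hi by simp
    then show "inv\<^bsub>Aut B\<^esub> s \<in> local_actions H"
      using hi_stab unfolding F by simp
  next
    fix s s' assume "s \<in> local_actions H" "s' \<in> local_actions H"
    then obtain g h where "g \<in> stab H x" "h \<in> stab H x" "s = \<sigma> g x" "s' = \<sigma> h x"
      unfolding F by blast
    then show "s \<otimes>\<^bsub>Aut B\<^esub> s' \<in> local_actions H"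
      unfolding F using stab_cocycle[OF _ _ x] stab_comp[OF _ _ x]
      by (intro image_eqI[of _ _ "gcomp T g h"]) simp_all
  qed
qed

text \<open>
  The chart at \<open>x\<close> is the isomorphism of graphs, and conjugation by it the isomorphism of groups:
  it sends the restriction of \<open>h\<close> to the ball to the local action of \<open>h\<close> at \<open>x\<close>.
\<close>

lemma action_isomorphic_local_actions:
  "iso_to_local_action T H k B (local_actions H)"
  unfolding iso_to_local_action_def
proof
  fix x assume x: "x \<in> V T"
  let ?A = "grestrict (ball x) ` stab H x"
  let ?c = "chart x"
  note c = chart_iso[OF x]
  define \<theta> where "\<theta> a = gcomp B (gcomp (ball x) ?c a) (ginverse (ball x) B ?c)" for a
  have \<theta>: "\<theta> (grestrict (ball x) h) = \<sigma> h x" if "h \<in> stab H x" for h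
  proof -
    have "gcomp (ball x) ?c (grestrict (ball x) h) = gcomp (ball x) ?c h"
      by (auto simp: gcomp_def compose_def grestrict_def)
    then show ?thesis
      using that by (simp add: \<theta>_def local_action_def stab_def)
  qed
  have rcomp: "gcomp (ball x) (grestrict (ball x) g) (grestrict (ball x) h) =
      grestrict (ball x) (gcomp T g h)" if "g \<in> stab H x" "h \<in> stab H x" for g h
  proof -
    have gh: "g \<in> graph_isos T T" "h \<in> graph_isos T T" "fst g x = x" "fst h x = x"
      using that H_iso by (simp_all add: stab_def)
    have rg: "grestrict (ball x) g \<in> graph_isos (ball x) (ball x)"
      and rh: "grestrict (ball x) h \<in> graph_isos (ball x) (ball x)"
      using grestrict_ball[OF gh(1) x, of k] grestrict_ball[OF gh(2) x, of k] gh by simp_all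
    have rgh: "grestrict (ball x) (gcomp T g h) \<in> graph_isos (ball x) (ball x)"
      using grestrict_ball[OF gcomp_isos[OF wf_tree gh(2,1)] x, of k] gh x by simp
    show ?thesis
    proof (rule gmap_eqI[OF gcomp_isos[OF wf_ball rh rg] rgh])
      show "fst (gcomp (ball x) (grestrict (ball x) g) (grestrict (ball x) h)) v =
          fst (grestrict (ball x) (gcomp T g h)) v" if v: "v \<in> V (ball x)" for v
        using v graph_isos_verts[OF rh v] verts_ball_subset[of x k] by (simp add: subset_iff)
      show "snd (gcomp (ball x) (grestrict (ball x) g) (grestrict (ball x) h)) e =
          snd (grestrict (ball x) (gcomp T g h)) e" if e: "e \<in> E (ball x)" for e
        using e graph_isos_arcs[OF rh e] arcs_ball_subset[of x k] by (simp add: subset_iff)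
    qed
  qed
  have "\<theta> \<in> iso ((Aut (ball x)) \<lparr> carrier := ?A \<rparr>) ((Aut B) \<lparr> carrier := local_actions H \<rparr>)"
    unfolding iso_def hom_def
  proof (intro CollectI conjI Pi_I ballI)
    show "bij_betw \<theta> (carrier ((Aut (ball x)) \<lparr> carrier := ?A \<rparr>))
        (carrier ((Aut B) \<lparr> carrier := local_actions H \<rparr>))"
      unfolding bij_betw_def
    proof
      have inj: "grestrict (ball x) g = grestrict (ball x) h"
        if gh: "g \<in> stab H x" "h \<in> stab H x" and eq: "\<sigma> g x = \<sigma> h x" for g h
      proof -
        have "g \<in> graph_isos T T" "h \<in> graph_isos T T" "fst g x = fst h x"
          using gh H_iso by (simp_all add: stab_def)
        then show ?thesis
          using local_action_eq_iff[of g h x] x eq by simp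
      qed
      have "inj_on \<theta> ?A"
      proof (rule inj_onI)
        fix a b assume "a \<in> ?A" "b \<in> ?A" and eq: "\<theta> a = \<theta> b"
        then obtain g h where gh: "g \<in> stab H x" "h \<in> stab H x"
          and ab: "a = grestrict (ball x) g" "b = grestrict (ball x) h" by blast
        have "\<sigma> g x = \<sigma> h x"
          using eq \<theta>[OF gh(1)] \<theta>[OF gh(2)] unfolding ab by simp
        then show "a = b" unfolding ab by (rule inj[OF gh])
      qed
      then show "inj_on \<theta> (carrier ((Aut (ball x)) \<lparr> carrier := ?A \<rparr>))" by simp
      show "\<theta> ` carrier ((Aut (ball x)) \<lparr> carrier := ?A \<rparr>) =
          carrier ((Aut B) \<lparr> carrier := local_actions H \<rparr>)"
        using \<theta> by (simp add: local_actions_stab[OF x] image_image)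
    qed
  next
    fix a assume "a \<in> carrier ((Aut (ball x)) \<lparr> carrier := ?A \<rparr>)"
    then show "\<theta> a \<in> carrier ((Aut B) \<lparr> carrier := local_actions H \<rparr>)"
      unfolding local_actions_stab[OF x] using \<theta> by auto
  next
    fix a b
    assume "a \<in> carrier ((Aut (ball x)) \<lparr> carrier := ?A \<rparr>)"
      and "b \<in> carrier ((Aut (ball x)) \<lparr> carrier := ?A \<rparr>)"
    then have "a \<in> ?A" "b \<in> ?A" by simp_all
    then obtain g h where gh: "g \<in> stab H x" "h \<in> stab H x"
      and ab: "a = grestrict (ball x) g" "b = grestrict (ball x) h" by blast
    show "\<theta> (a \<otimes>\<^bsub>(Aut (ball x)) \<lparr> carrier := ?A \<rparr>\<^esub> b) =
        \<theta> a \<otimes>\<^bsub>(Aut B) \<lparr> carrier := local_actions H \<rparr>\<^esub> \<theta> b"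
      using stab_cocycle[OF gh x] rcomp[OF gh] \<theta>[OF stab_comp[OF gh x]] \<theta>[OF gh(1)] \<theta>[OF gh(2)]
      by (simp add: ab)
  qed
  moreover have "gcomp (ball x) ?c a = gcomp (ball x) (\<theta> a) ?c" if a_in: "a \<in> ?A" for a
  proof -
    obtain h where h: "h \<in> stab H x" "a = grestrict (ball x) h"
      using a_in by blast
    then have hT: "h \<in> graph_isos T T" "fst h x = x"
      using H_iso by (simp_all add: stab_def)
    have a: "a \<in> graph_isos (ball x) (ball x)"
      using grestrict_ball[OF hT(1) x, of k] hT(2) h(2) by simp
    have s: "\<theta> a \<in> graph_isos B B"
      using \<theta>[OF h(1)] local_action_iso[OF hT(1) x] h(2) by simp
    show ?thesis
    proof (rule gmap_eqI[OF gcomp_isos[OF wf_ball a c] gcomp_isos[OF wf_ball c s]])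
      show "fst (gcomp (ball x) ?c a) v = fst (gcomp (ball x) (\<theta> a) ?c) v" if "v \<in> V (ball x)" for v
        using that local_action_apply(1)[OF x that, of h] hT(2) h(2) \<theta>[OF h(1)] by simp
      show "snd (gcomp (ball x) ?c a) e = snd (gcomp (ball x) (\<theta> a) ?c) e" if "e \<in> E (ball x)" for e
        using that local_action_apply(2)[OF x that, of h] hT(2) h(2) \<theta>[OF h(1)] by simp
    qed
  qed
  ultimately show "action_isomorphic (ball x) ?A B (local_actions H)"
    unfolding action_isomorphic_def by (intro bexI[OF _ c] bexI[of _ \<theta>] ballI)
qed

lemma univ_group_id_subset: "univ_group T B lB l k {\<one>\<^bsub>Aut B\<^esub>} \<subseteq> H"
proof
  fix g assume "g \<in> univ_group T B lB l k {\<one>\<^bsub>Aut B\<^esub>}"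
  then have "g \<in> label_isos T l T l"
    by (intro label_iso_if_local_action_id) (simp_all add: univ_group_def)
  then show "g \<in> H" using label_H by blast
qed

end

end

section \<open>The descending chain of universal groups\<close>

text \<open>
  At a vertex \<open>x\<close>, the local action of \<open>g\<close> on the larger ball is that of some \<open>h \<in> H\<close> fixing \<open>x\<close>.
  A label-preserving automorphism moves \<open>fst g x\<close> back to \<open>x\<close> without changing local actions.
  After that, \<open>g\<close> and \<open>h\<close> agree on the larger ball, hence on the smaller one.
\<close>

lemma univ_group_antimono:
  assumes small: "ball_charts T \<Omega> l k B lB" and large: "ball_charts T \<Omega> l (Suc k) B' lB'"
    and H: "subgroup H (Aut T)" and label_H: "label_isos T l T l \<subseteq> H"
  shows "univ_group T B' lB' l (Suc k) (ball_charts.local_actions T l (Suc k) B' lB' H)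
    \<subseteq> univ_group T B lB l k (ball_charts.local_actions T l k B lB H)"
proof
  interpret small: ball_charts T \<Omega> l k B lB by (rule small)
  interpret large: ball_charts T \<Omega> l "Suc k" B' lB' by (rule large)
  fix g assume g: "g \<in> univ_group T B' lB' l (Suc k) (large.local_actions H)"
  then have gT: "g \<in> graph_isos T T" by (simp add: univ_group_def)
  have "small.\<sigma> g x \<in> small.local_actions H" if x: "x \<in> V T" for x
  proof -
    have "large.\<sigma> g x \<in> (\<lambda>h. large.\<sigma> h x) ` stab H x"
      using g x unfolding large.local_actions_stab[OF H label_H x, symmetric]
      by (simp add: univ_group_def)
    then obtain h where h: "h \<in> H" "fst h x = x" "large.\<sigma> g x = large.\<sigma> h x"
      unfolding stab_def by blast
    have hT: "h \<in> graph_isos T T" by (rule large.H_iso[OF H label_H h(1)])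
    obtain b where b: "b \<in> label_isos T l T l" "fst b (fst g x) = x"
      using small.label_iso_exists[OF small.l small.l graph_isos_verts[OF gT x] x] by blast
    note id = gid_label_isos[OF small.wf_tree, of l]
    define g' where "g' = gcomp T b (gcomp T g (gid T))"
    have g': "g' \<in> graph_isos T T" "fst g' x = x"
      using gcomp_isos[OF small.wf_tree gT label_isosD(1)[OF b(1)]] gcomp_gid_right[OF gT] b(2) x
      by (simp_all add: g'_def)
    have "large.\<sigma> g' x = large.\<sigma> h x" and sg: "small.\<sigma> g' x = small.\<sigma> g x"
      using large.local_action_conjugate[OF gT id b(1) x]
        small.local_action_conjugate[OF gT id b(1) x] h(3) x by (simp_all add: g'_def)
    then have eq: "grestrict (cball_of T x (Suc k)) g' = grestrict (cball_of T x (Suc k)) h"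
      using large.local_action_eq_iff[OF g'(1) hT x] g'(2) h(2) by simp
    have v: "fst g' v = fst h v" if "v \<in> V (cball_of T x (Suc k))" for v
      using grestrict_apply(1)[OF that, of g'] grestrict_apply(1)[OF that, of h] eq by simp
    have e: "snd g' e = snd h e" if "e \<in> E (cball_of T x (Suc k))" for e
      using grestrict_apply(2)[OF that, of g'] grestrict_apply(2)[OF that, of h] eq by simp
    have "grestrict (cball_of T x k) g' = grestrict (cball_of T x k) h"
      unfolding grestrict_def
      using v[OF subsetD[OF small.verts_ball_mono]] e[OF subsetD[OF small.arcs_ball_mono]]
      by (intro arg_cong2[where f = Pair] restrict_ext)
    then have "small.\<sigma> g' x = small.\<sigma> h x"
      using small.local_action_eq_iff[OF g'(1) hT x] g'(2) h(2) by simp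
    then show ?thesis
      using sg h(1) x unfolding small.local_actions_def by (intro CollectI exI[of _ h] exI[of _ x]) simp
  qed
  then show "g \<in> univ_group T B lB l k (small.local_actions H)"
    using gT by (simp add: univ_group_def)
qed

theorem theorem3p34:
  fixes d :: nat
    and \<Omega> :: "'o set"
    and T :: "('v, 'e) serre_graph"
    and B :: "nat \<Rightarrow> ('w, 'f) serre_graph"
    and lB :: "nat \<Rightarrow> 'f \<Rightarrow> 'o"
    and H :: "('v, 'e, 'v, 'e) gmap set"
  assumes "d \<ge> 3"
    and "card \<Omega> = d"
    and "regular_tree d T"
    and "\<And>k. k \<ge> 1 \<Longrightarrow> labelled_ball_model T \<Omega> k (B k) (lB k)"
    and "subgroup H (Aut T)"
    and "locally_transitive T H"
    and "\<exists>g \<in> H. involutive_inversion T g"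
  shows "\<exists>l. is_labelling T \<Omega> l \<and>
    (\<exists>F :: nat \<Rightarrow> ('w, 'f, 'w, 'f) gmap set.
      (\<forall>k \<ge> 1. subgroup (F k) (Aut (B k)) \<and> iso_to_local_action T H k (B k) (F k)) \<and>
      (\<forall>k \<ge> 1. univ_group T (B (k + 1)) (lB (k + 1)) l (k + 1) (F (k + 1))
                 \<subseteq> univ_group T (B k) (lB k) l k (F k)) \<and>
      (\<forall>k \<ge> 1. H \<subseteq> univ_group T (B k) (lB k) l k (F k)) \<and>
      univ_group T (B 1) (lB 1) l 1 {\<one>\<^bsub>Aut (B 1)\<^esub>} \<subseteq> H)"
proof -
  interpret serre_tree T
    using assms(3) by unfold_locales (simp add: regular_tree_def)
  obtain g e where g: "g \<in> H" "involutive_inversion T g" and e: "e \<in> E T" "snd g e = bar T e"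
    using assms(7) unfolding involutive_inversion_def is_inversion_def by blast
  define x0 where "x0 = tail (und T) e"
  let ?A = "out_arcs (und T) x0"
  have x0: "x0 \<in> V T" and eA: "e \<in> ?A"
    using e by (simp_all add: x0_def)
  have "\<exists>t. t \<in> H \<and> snd t a = bar T a \<and> gcomp T t t = gid T" if a: "a \<in> ?A" for a
  proof -
    obtain h where "h \<in> stab H x0" "snd h e = a"
      using assms(6) x0 eA a unfolding locally_transitive_def by blast
    then show ?thesis
      using conjugate_inversion[OF assms(5) g e(2,1), of h] unfolding stab_def by blast
  qed
  then obtain t where t: "\<And>a. a \<in> ?A \<Longrightarrow> t a \<in> H \<and> snd (t a) a = bar T a \<and> gcomp T (t a) (t a) = gid T"
    by metis
  interpret inversion_family T H x0 t
    by (intro inversion_family.intro inversion_family_axioms.intro serre_tree_axioms assms(5) x0)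
      (use t in blast)+
  have "card ?A = card \<Omega>"
    using assms(2,3) x0 by (simp add: regular_tree_def out_degree_def)
  moreover have "finite ?A" "finite \<Omega>"
    using assms(1,2) calculation by (simp_all add: card_ge_0_finite)
  ultimately obtain b where b: "bij_betw b ?A \<Omega>"
    using finite_same_card_bij by blast
  define l where "l = orbit_label b"
  have l: "is_labelling T \<Omega> l" and lH: "label_isos T l T l \<subseteq> H"
    unfolding l_def by (rule orbit_label_labelling[OF b], rule label_autos_subset[OF b])
  have charts: "ball_charts T \<Omega> l k (B k) (lB k)" if "k \<ge> 1" for k
    using that assms(1,2) assms(4)[OF that] l
    by (intro ball_charts.intro ball_charts_axioms.intro serre_tree_axioms) simp_all
  define F where "F k = ball_charts.local_actions T l k (B k) (lB k) H" for k
  show ?thesis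
  proof (intro exI[of _ l] exI[of _ F] conjI allI impI l)
    fix k :: nat assume k: "k \<ge> 1"
    interpret ball_charts T \<Omega> l k "B k" "lB k" by (rule charts[OF k])
    show "subgroup (F k) (Aut (B k))"
      unfolding F_def by (rule subgroup_local_actions[OF assms(5) lH])
    show "iso_to_local_action T H k (B k) (F k)"
      unfolding F_def by (rule action_isomorphic_local_actions[OF assms(5) lH])
    show "H \<subseteq> univ_group T (B k) (lB k) l k (F k)"
      unfolding F_def by (rule subset_univ_group[OF assms(5) lH])
    show "univ_group T (B (k + 1)) (lB (k + 1)) l (k + 1) (F (k + 1))
        \<subseteq> univ_group T (B k) (lB k) l k (F k)"
      using univ_group_antimono[OF charts[OF k] charts[of "Suc k"] assms(5) lH]
      unfolding F_def by simp
  next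
    interpret ball_charts T \<Omega> l 1 "B 1" "lB 1" by (rule charts) simp
    show "univ_group T (B 1) (lB 1) l 1 {\<one>\<^bsub>Aut (B 1)\<^esub>} \<subseteq> H"
      by (rule univ_group_id_subset[OF assms(5) lH])
  qed
qed

end
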